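(* Let $(X_i)_{i\ge 1}$ be independent (not necessarily identically distributed) nonnegative absolutely continuous random variables, where $X_i$ has a probability density function $f_i$ (with $f_i=0$ on $(-\infty,0)$) that is bounded on $\mathbb{R}_+=[0,\infty)$ and has only finitely many discontinuities in $\mathbb{R}_+$, and cumulative distribution function $F_i$. For $n\ge 1$ let $Y_n=\sum_{i=1}^n X_i$, $Z_n=\max_{1\le i\le n}X_i$, $G_n(y,z)=P(Y_n\le y,Z_n\le z)$, and $\mathcal{D}_n=\{(y,z)\in\mathbb{R}_+^2: z\le y\le nz\}$. Then: (1) For all integers $n\ge 2$ and all $(y,z)\in\mathbb{R}_+^2$, $$G_n(y,z)=\int_0^z G_{n-1}(y-x,z)f_n(x)\,dx=\int_0^{\min(y,z)}G_{n-1}(y-x,z)f_n(x)\,dx,$$ with $G_1(y,z)=F_1(\min(y,z))$ for all $(y,z)\in\mathbb{R}_+^2$, and $G_n$ is continuous on $\mathbb{R}_+^2$ for all $n\ge 1$. (2) The joint PDF $g_n$ of $(Y_n,Z_n)$, which vanishes outside $\mathcal D_n$, is given by $$\begin{aligned} g_n(y,z)&=f_n(z)\int_0^z g_{n-1}(y-z,x)\,dx+\int_0^z f_n(x)\,g_{n-1}(y-x,z)\,dx\\ &=f_n(z)\int_{\frac{y-z}{n-1}}^{\min(y-z,z)}g_{n-1}(y-z,x)\,dx+\int_{\max(y-(n-1)z,0)}^{\min(y-z,z)}f_n(x)\,g_{n-1}(y-x,z)\,dx\end{aligned}$$ for all integers $n\ge 2$ and all $(y,z)\in\mathcal D_n$,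 with initial condition $g_1(y,z)=f_1(y)\,\delta(y-z)=f_1(z)\,\delta(y-z)$ for $(y,z)\in\mathcal D_1$, where $\delta$ is the Dirac delta. Furthermore, for all integers $n\ge 2$, $g_n$ is continuous almost everywhere and bounded on $\mathcal{D}_n$, and the integral $\int_0^z g_n(y-z,x)\,dx$ is bounded as a function of $(y,z)$ on $\mathcal{D}_{n+1}$.
   Context: $G_n(y,z)=0$ whenever $y<0$ or $z<0$. The joint PDF $g_n$ of $(Y_n,Z_n)$ is the function (a generalized function if $n=1$), extended by $0$ outside $\mathcal D_n$, with $G_n(y,z)=\int_0^z\int_0^y g_n(y',z')\,dy'\,dz'$ for all $(y,z)\in\mathbb{R}_+^2$. A PDF is unique up to equality almost everywhere; the claim is that the functions produced by the recurrence (extended by zero) are versions of the joint PDFs and that these versions have the stated properties. "Almost everywhere" refers to two-dimensional Lebesgue measure. Dirac delta convention: $\delta(x)\ge 0$, $\delta(-x)=\delta(x)$, and for $a\le b$, $\int_a^b f(t)\,\delta(t-s)\,dt=f(s)$ if $a\le s\le b$ and $0$ otherwise. Endpoints count with full mass, including the case $a=b=s$. Thus, concretely, $\int_0^z g_1(u,x)\,dx=f_1(u)$ if $0\le u\le z$ and $0$ otherwise, and $\int_0^z f_2(x)\,g_1(y-x,z)\,dx=f_2(y-z)f_1(z)$ if $0\le y-z\le z$ and $0$ otherwise. For $n=1$ the claim about $g_1$ means $\int_0^z\int_0^y g_1(y',z')\,dy'\,dz'=P(X_1\le\min(y,z))$ for all $(y,z)\in\mathbb{R}_+^2$. *)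

theory Defs
  imports "HOL-Probability.Probability"
begin

definition Y :: "(nat \<Rightarrow> 'a \<Rightarrow> real) \<Rightarrow> nat \<Rightarrow> 'a \<Rightarrow> real" where
  "Y X n \<omega> = (\<Sum>i=1..n. X i \<omega>)"

definition Z :: "(nat \<Rightarrow> 'a \<Rightarrow> real) \<Rightarrow> nat \<Rightarrow> 'a \<Rightarrow> real" where
  "Z X n \<omega> = Max ((\<lambda>i. X i \<omega>) ` {1..n})"

definition joint_cdf :: "'a measure \<Rightarrow> (nat \<Rightarrow> 'a \<Rightarrow> real) \<Rightarrow> nat \<Rightarrow> real \<Rightarrow> real \<Rightarrow> real" where
  "joint_cdf M X n y z = measure M {\<omega> \<in> space M. Y X n \<omega> \<le> y \<and> Z X n \<omega> \<le> z}"

definition D :: "nat \<Rightarrow> (real \<times> real) set" where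
  "D n = {(y, z). 0 \<le> y \<and> 0 \<le> z \<and> z \<le> y \<and> y \<le> real n * z}"

text \<open>
  \<open>Regular h\<close> is the ordinary function \<open>h(y,z)\<close>; \<open>Diagonal k\<close> is the generalized function
  \<open>k(y,z) \<delta>(y - z)\<close>.
\<close>

datatype gen_density =
    Regular "real \<Rightarrow> real \<Rightarrow> real"
  | Diagonal "real \<Rightarrow> real \<Rightarrow> real"

text \<open>
  \<open>line_integral g \<phi> p a b\<close> is the integral of \<open>\<phi>(t) g(p(t))\<close> over \<open>t\<close> from \<open>a\<close> to \<open>b\<close>, for
  \<open>a \<le> b\<close>. It is meant for lines \<open>p\<close> parallel to a coordinate axis and traversed at unit speed.
  With \<open>p(t) = (p1(t), p2(t))\<close> one then has \<open>p1(t) - p2(t) = t - s\<close> or \<open>p1(t) - p2(t) = s - t\<close>, where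
  \<open>s\<close> is the unique parameter at which \<open>p\<close> meets the diagonal. Since the Dirac delta is even,
  \<open>\<delta>(p1(t) - p2(t)) = \<delta>(t - s)\<close>, which evaluates the remaining factor at \<open>s\<close> if \<open>a \<le> s \<le> b\<close>
  (endpoints count with full mass, also for \<open>a = b = s\<close>) and gives \<open>0\<close> otherwise.
\<close>

fun line_integral ::
  "gen_density \<Rightarrow> (real \<Rightarrow> real) \<Rightarrow> (real \<Rightarrow> real \<times> real) \<Rightarrow> real \<Rightarrow> real \<Rightarrow> real" where
  "line_integral (Regular h) \<phi> p a b =
     (LINT t:{a..b}|lborel. \<phi> t * h (fst (p t)) (snd (p t)))"
| "line_integral (Diagonal k) \<phi> p a b =
     (let s = (THE s. fst (p s) = snd (p s))
      in if a \<le> s \<and> s \<le> b then \<phi> s * k (fst (p s)) (snd (p s)) else 0)"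

text \<open>
  The functions produced by the recurrence, extended by \<open>0\<close> outside \<open>D n\<close>. The random variables,
  and hence the densities \<open>f i\<close>, are indexed from \<open>1\<close>; the value at \<open>n = 0\<close> is a dummy.
\<close>

fun joint_pdf :: "(nat \<Rightarrow> real \<Rightarrow> real) \<Rightarrow> nat \<Rightarrow> gen_density" where
  "joint_pdf f 0 = Regular (\<lambda>_ _. 0)"
| "joint_pdf f (Suc 0) = Diagonal (\<lambda>y z. f 1 y)"
| "joint_pdf f (Suc (Suc n)) = Regular (\<lambda>y z.
     if (y, z) \<in> D (Suc (Suc n)) then
       f (Suc (Suc n)) z * line_integral (joint_pdf f (Suc n)) (\<lambda>_. 1) (\<lambda>x. (y - z, x)) 0 z
       + line_integral (joint_pdf f (Suc n)) (f (Suc (Suc n))) (\<lambda>x. (y - x, z)) 0 z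
     else 0)"

end

theory Submission
  imports Defs
begin

text \<open>
  Conditioning on \<open>X\<^sub>n = x\<close> turns \<open>(Y\<^sub>n\<^sub>-\<^sub>1, Z\<^sub>n\<^sub>-\<^sub>1)\<close> into \<open>(Y\<^sub>n\<^sub>-\<^sub>1 + x, max Z\<^sub>n\<^sub>-\<^sub>1 x)\<close>. In the
  expectation of a test function \<open>\<phi>(Y\<^sub>n, Z\<^sub>n)\<close>, splitting at \<open>Z\<^sub>n\<^sub>-\<^sub>1 \<le> x\<close> and \<open>Z\<^sub>n\<^sub>-\<^sub>1 > x\<close>, translating
  the first variable and applying Tonelli's theorem produces exactly the two summands of the
  recurrence. The density at level \<open>n\<close> is bounded because the first summand is controlled by the
  marginal of \<open>g\<^sub>n\<^sub>-\<^sub>1\<close> in the first coordinate and the second by the supremum of \<open>g\<^sub>n\<^sub>-\<^sub>1\<close>.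
  Almost everywhere continuity propagates by dominated convergence, since almost every horizontal
  and vertical section of a null set is null.
\<close>

text \<open>The obstacle is that the density at level 1 is concentrated on the diagonal and is not a
  function, so an invariant about bounded planar densities cannot start there. It starts at level 2,
  where the delta has been integrated out (\<open>pdf_two\<close>), and is passed on by
  \<open>pdf_step\<close>. Boundedness alone does not reproduce itself: the section of
  \<open>D n\<close> over first coordinate \<open>w\<close> has length \<open>w - w / n\<close>, so
  a bounded function supported in \<open>D n\<close> need not have uniformly bounded integrals along
  these sections. Hence the separate marginal bound in \<open>nice_joint\<close>. It is required for
  every \<open>w\<close>, because the recurrence evaluates the marginal at the single point
  \<open>y - z\<close>. The law is stated for all measurable test functions, since the induction
  replaces \<open>\<phi>\<close> by its composition with
  \<open>(y, z) \<mapsto> (y + x, max z x)\<close>; indicators of Borel sets then yield the density,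
  and indicators of quadrants the recursion for the distribution function. Ties between the old
  maximum and the new variable fill only null sets, so the closed endpoints of the recurrence do not
  disturb the law.\<close>

section \<open>Regularity invariants and the two forms of the recurrence\<close>

definition nice_density :: "(real \<Rightarrow> real) \<Rightarrow> bool" where
  "nice_density f \<longleftrightarrow> f \<in> borel_measurable borel \<and> (\<forall>x. 0 \<le> f x) \<and> (\<forall>x<0. f x = 0) \<and>
     (\<exists>B. \<forall>x. f x \<le> B) \<and> (\<integral>\<^sup>+x. ennreal (f x) \<partial>lborel) = 1 \<and> (AE x in lborel. isCont f x)"

definition nice_joint :: "nat \<Rightarrow> (real \<Rightarrow> real \<Rightarrow> real) \<Rightarrow> bool" where
  "nice_joint n h \<longleftrightarrow> (\<lambda>p. h (fst p) (snd p)) \<in> borel_measurable borel \<and> (\<forall>y z. 0 \<le> h y z) \<and>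
     (\<forall>y z. (y, z) \<notin> D n \<longrightarrow> h y z = 0) \<and> (\<exists>C. \<forall>y z. h y z \<le> C) \<and>
     (\<exists>Q. \<forall>w. (\<integral>\<^sup>+x. ennreal (h w x) \<partial>lborel) \<le> ennreal Q) \<and>
     (AE p in lborel. isCont (\<lambda>p. h (fst p) (snd p)) p)"

text \<open>The recurrence at level 2 with the delta already evaluated: both lines of integration
  meet the diagonal at parameter \<open>y - z\<close>, which lies in \<open>{0..z}\<close> for every
  point of \<open>D 2\<close>.\<close>

definition pdf_two :: "(real \<Rightarrow> real) \<Rightarrow> (real \<Rightarrow> real) \<Rightarrow> real \<Rightarrow> real \<Rightarrow> real" where
  "pdf_two f1 f2 y z = (if (y, z) \<in> D 2 then f2 z * f1 (y - z) + f2 (y - z) * f1 z else 0)"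

text \<open>No cut-off to a domain is built in; for \<open>h\<close> supported in \<open>D n\<close>
  the support comes out right by itself, see \<open>pdf_step_outside_D\<close>.\<close>

definition pdf_step :: "(real \<Rightarrow> real) \<Rightarrow> (real \<Rightarrow> real \<Rightarrow> real) \<Rightarrow> real \<Rightarrow> real \<Rightarrow> real" where
  "pdf_step f h y z = f z * (LINT x:{0..z}|lborel. h (y - z) x) + (LINT x:{0..z}|lborel. f x * h (y - x) z)"

section \<open>Continuity of integrals in a parameter\<close>

text \<open>Continuity at a point of a metric space can be tested on sequences, where dominated
  convergence applies. The majorant is required only near \<open>q\<close>, because an interval of
  integration with a moving endpoint has no global integrable majorant.\<close>

lemma isCont_lebesgue_integral:
  fixes F :: "'a::metric_space \<Rightarrow> 'b \<Rightarrow> real"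
  assumes F: "\<And>p. F p \<in> borel_measurable M" and w: "integrable M w"
    and c: "AE x in M. isCont (\<lambda>p. F p x) q"
    and b: "eventually (\<lambda>p. AE x in M. norm (F p x) \<le> w x) (nhds q)"
  shows "isCont (\<lambda>p. \<integral>x. F p x \<partial>M) q"
  unfolding continuous_at_sequentially comp_def
proof (intro allI impI)
  fix u :: "nat \<Rightarrow> 'a" assume u: "u \<longlonglongrightarrow> q"
  have "eventually (\<lambda>i. AE x in M. norm (F (u i) x) \<le> w x) sequentially"
    using b u by (rule eventually_compose_filterlim)
  then obtain N where N: "\<And>i. i \<ge> N \<Longrightarrow> AE x in M. norm (F (u i) x) \<le> w x"
    by (auto simp: eventually_sequentially)
  have "(\<lambda>i. \<integral>x. F (u (i + N)) x \<partial>M) \<longlonglongrightarrow> (\<integral>x. F q x \<partial>M)"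
  proof (rule integral_dominated_convergence[OF F F w])
    show "AE x in M. (\<lambda>i. F (u (i + N)) x) \<longlonglongrightarrow> F q x"
      using c
    proof eventually_elim
      case (elim x)
      then show ?case
        using isCont_tendsto_compose[OF elim LIMSEQ_ignore_initial_segment[OF u, of N]] by simp
    qed
    show "AE x in M. norm (F (u (i + N)) x) \<le> w x" for i
      by (rule N) simp
  qed
  then show "(\<lambda>i. \<integral>x. F (u i) x \<partial>M) \<longlonglongrightarrow> (\<integral>x. F q x \<partial>M)"
    by (rule LIMSEQ_offset)
qed

text \<open>The sign of \<open>v - u\<close> is locally constant where this continuous function is
  nonzero. This makes indicators of sets given by inequalities continuous off the boundary.\<close>

lemma eventually_le_iff:
  fixes u v :: "'a::t2_space \<Rightarrow> real"
  assumes u: "isCont u q" and v: "isCont v q" and ne: "u q \<noteq> v q"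
  shows "eventually (\<lambda>p. u p \<le> v p \<longleftrightarrow> u q \<le> v q) (nhds q)"
proof -
  have l: "((\<lambda>p. v p - u p) \<longlongrightarrow> v q - u q) (nhds q)"
    using u v by (auto simp: continuous_at intro!: tendsto_diff simp flip: tendsto_at_iff_tendsto_nhds)
  show ?thesis
  proof (cases "u q < v q")
    case True
    then have "eventually (\<lambda>p. 0 < v p - u p) (nhds q)"
      by (intro order_tendstoD(1)[OF l]) simp
    then show ?thesis by eventually_elim (use True in auto)
  next
    case False
    then have "eventually (\<lambda>p. v p - u p < 0) (nhds q)"
      using ne by (intro order_tendstoD(2)[OF l]) simp
    then show ?thesis by eventually_elim (use False ne in auto)
  qed
qed

lemma isCont_eventually_const:
  assumes "eventually (\<lambda>p. F p = F q) (nhds q)"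
  shows "isCont F q"
  using isCont_cong[OF assms] by simp

lemma isCont_indicator_Icc:
  fixes x :: real
  assumes z: "isCont z q" and x: "x \<noteq> z q"
  shows "isCont (\<lambda>p. indicator {0..z p} x :: real) q"
proof (rule isCont_eventually_const)
  show "eventually (\<lambda>p. indicator {0..z p} x = (indicator {0..z q} x :: real)) (nhds q)"
    using eventually_le_iff[OF continuous_const z x]
    by eventually_elim (auto simp: indicator_def)
qed

section \<open>Null sets on the line and in the plane\<close>

text \<open>\<open>P\<close> will be a continuity predicate whose truth set is not known to be
  measurable. Passing to a Borel null set that contains all exceptions makes preimages and sections
  accessible to the measure-theoretic rules.\<close>

lemma lborel_AE_borel_null:
  fixes P :: "'a::euclidean_space \<Rightarrow> bool"
  assumes "AE x in lborel. P x"
  obtains N where "N \<in> sets borel" "AE x in lborel. x \<notin> N" "\<And>x. x \<notin> N \<Longrightarrow> P x"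
proof -
  obtain N where N: "{x. \<not> P x} \<subseteq> N" "N \<in> null_sets lborel"
    using assms by (auto simp: eventually_ae_filter)
  show ?thesis
    by (rule that[of N]) (use N in \<open>auto intro!: AE_not_in simp: null_sets_def\<close>)
qed

lemma lborel_AE_affine:
  assumes "AE x in (lborel :: real measure). P x" and c: "c \<noteq> 0"
  shows "AE x in lborel. P (t + c * x)"
proof -
  obtain N where N[measurable]: "N \<in> sets borel" and *: "AE x in lborel. x \<notin> N" "\<And>x. x \<notin> N \<Longrightarrow> P x"
    using lborel_AE_borel_null[OF assms(1)] by blast
  have "AE x in lborel. t + c * x \<notin> N"
    by (intro AE_borel_affine[OF c] *) measurable
  then show ?thesis by eventually_elim (use * in auto)
qed

text \<open>The preimage of a null set under a nonzero linear functional is null: if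
  \<open>c \<noteq> 0\<close>, each section with fixed first coordinate is an affine preimage of the
  null set; if \<open>c = 0\<close>, almost every such section is empty.\<close>

lemma lborel2_AE_linear:
  assumes "AE x in (lborel :: real measure). P x" and ac: "a \<noteq> 0 \<or> c \<noteq> 0"
  shows "AE p in (lborel :: (real \<times> real) measure). P (a * fst p + c * snd p)"
proof -
  obtain N where N[measurable]: "N \<in> sets borel" and *: "AE x in lborel. x \<notin> N" "\<And>x. x \<notin> N \<Longrightarrow> P x"
    using lborel_AE_borel_null[OF assms(1)] by blast
  have "AE y in lborel. AE z in lborel. a * y + c * z \<notin> N"
  proof (cases "c = 0")
    case True
    then have "AE y in lborel. 0 + a * y \<notin> N"
      using ac by (intro lborel_AE_affine[OF *(1)]) auto
    then show ?thesis using True by auto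
  next
    case False
    then show ?thesis by (intro AE_I2 lborel_AE_affine[OF *(1)])
  qed
  moreover have "{p \<in> space (lborel \<Otimes>\<^sub>M lborel). a * fst p + c * snd p \<notin> N} \<in> sets (lborel \<Otimes>\<^sub>M lborel)"
    by measurable
  ultimately have "AE p in lborel \<Otimes>\<^sub>M (lborel::real measure). a * fst p + c * snd p \<notin> N"
    by (intro lborel_pair.AE_pair_measure) auto
  then show ?thesis unfolding lborel_prod by eventually_elim (use * in auto)
qed

text \<open>Tonelli for a Borel null set containing the exceptions; measurability of that set is
  what allows the two almost-everywhere quantifiers to be exchanged.\<close>

lemma lborel2_AE_sections:
  assumes "AE p in (lborel :: (real \<times> real) measure). P p"
  shows "AE x in lborel. AE y in lborel. P (x, y)" "AE y in lborel. AE x in lborel. P (x, y)"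
proof -
  obtain N where N: "N \<in> sets borel" and *: "AE x in lborel. x \<notin> N" "\<And>x. x \<notin> N \<Longrightarrow> P x"
    using lborel_AE_borel_null[OF assms(1)] by blast
  have [measurable]: "N \<in> sets (borel \<Otimes>\<^sub>M borel)" using N unfolding borel_prod .
  have "AE p in lborel \<Otimes>\<^sub>M lborel. p \<notin> N"
    using *(1) unfolding lborel_prod .
  then have 1: "AE x in lborel. AE y in lborel. (x, y) \<notin> N"
    by (rule lborel_pair.AE_pair)
  show "AE x in lborel. AE y in lborel. P (x, y)"
    using 1 by eventually_elim (erule eventually_mono, use * in auto)
  have "{p \<in> space (lborel \<Otimes>\<^sub>M lborel). (fst p, snd p) \<notin> N} \<in> sets (lborel \<Otimes>\<^sub>M lborel)"
    by measurable
  then have "AE y in lborel. AE x in lborel. (x, y) \<notin> N"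
    using lborel_pair.AE_commute[of "\<lambda>x y. (x, y) \<notin> N"] 1 by blast
  then show "AE y in lborel. AE x in lborel. P (x, y)"
    by eventually_elim (erule eventually_mono, use * in auto)
qed

lemma lborel2_AE_D_boundary:
  "AE p in (lborel :: (real \<times> real) measure).
     fst p \<noteq> 0 \<and> snd p \<noteq> 0 \<and> snd p \<noteq> fst p \<and> fst p \<noteq> a * snd p"
proof -
  have 0: "AE x in (lborel::real measure). x \<noteq> 0"
    by (rule AE_lborel_singleton)
  show ?thesis
    using lborel2_AE_linear[OF 0, of 1 0] lborel2_AE_linear[OF 0, of 0 1]
      lborel2_AE_linear[OF 0, of 1 "-1"] lborel2_AE_linear[OF 0, of 1 "-a"]
    by auto
qed

text \<open>\<open>D n\<close> is cut out by four linear inequalities, and off the four lines none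
  of them changes its truth value locally.\<close>

lemma isCont_indicator_D:
  assumes "fst p \<noteq> 0" "snd p \<noteq> 0" "snd p \<noteq> fst p" "fst p \<noteq> real n * snd p"
  shows "isCont (indicator (D n) :: real \<times> real \<Rightarrow> real) p"
proof (rule isCont_eventually_const)
  have "eventually (\<lambda>q. (0 \<le> fst q) = (0 \<le> fst p)) (nhds p)"
    "eventually (\<lambda>q. (0 \<le> snd q) = (0 \<le> snd p)) (nhds p)"
    "eventually (\<lambda>q. (snd q \<le> fst q) = (snd p \<le> fst p)) (nhds p)"
    "eventually (\<lambda>q. (fst q \<le> real n * snd q) = (fst p \<le> real n * snd p)) (nhds p)"
    using assms by (intro eventually_le_iff; simp)+
  then show "eventually (\<lambda>q. indicator (D n) q = (indicator (D n) p :: real)) (nhds p)"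
    by eventually_elim (auto simp: indicator_def D_def)
qed

section \<open>Consequences of the invariants and measurability\<close>

lemma nice_densityD:
  assumes "nice_density f"
  shows "f \<in> borel_measurable borel" "0 \<le> f x" "x < 0 \<Longrightarrow> f x = 0"
    "(\<integral>\<^sup>+x. ennreal (f x) \<partial>lborel) = 1" "AE x in lborel. isCont f x"
  using assms by (auto simp: nice_density_def)

lemma nice_density_bound:
  assumes "nice_density f"
  obtains B where "\<And>x. f x \<le> B" "0 \<le> B"
  using assms unfolding nice_density_def by (metis order_trans)

lemma nice_jointD:
  assumes "nice_joint n h"
  shows "(\<lambda>p. h (fst p) (snd p)) \<in> borel_measurable borel" "0 \<le> h y z" "(y, z) \<notin> D n \<Longrightarrow> h y z = 0"
    "AE p in lborel. isCont (\<lambda>p. h (fst p) (snd p)) p"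
  using assms by (auto simp: nice_joint_def)

lemma nice_joint_bound:
  assumes "nice_joint n h"
  obtains C where "\<And>y z. h y z \<le> C" "0 \<le> C"
  using assms unfolding nice_joint_def by (metis order_trans)

lemma nice_joint_marginal_bound:
  assumes "nice_joint n h"
  obtains Q where "\<And>w. (\<integral>\<^sup>+x. ennreal (h w x) \<partial>lborel) \<le> ennreal Q" "0 \<le> Q"
proof -
  obtain Q where "\<And>w. (\<integral>\<^sup>+x. ennreal (h w x) \<partial>lborel) \<le> ennreal Q"
    using assms unfolding nice_joint_def by auto
  then show ?thesis
    by (intro that[of "max 0 Q"]) (auto simp: ennreal_max_0 max.commute intro: order_trans)
qed

lemma nice_joint_measurable [measurable_dest]:
  "nice_joint n h \<Longrightarrow> case_prod h \<in> borel_measurable (borel \<Otimes>\<^sub>M borel)"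
  using nice_jointD(1) unfolding borel_prod case_prod_beta' .

lemma nice_joint_measurable2:
  assumes "nice_joint n h" "u \<in> borel_measurable M" "v \<in> borel_measurable M"
  shows "(\<lambda>x. h (u x) (v x)) \<in> borel_measurable M"
  using measurable_compose[OF measurable_Pair[OF assms(2,3)] nice_joint_measurable[OF assms(1)]] by simp

lemma nice_density_measurable [measurable_dest]: "nice_density f \<Longrightarrow> f \<in> borel_measurable borel"
  by (rule nice_densityD)

lemma nice_density_integrable: "nice_density f \<Longrightarrow> integrable lborel f"
  by (intro integrableI_nonneg) (auto simp: nice_densityD)

text \<open>The interval moves with the point, so this is not the indicator of a fixed set; written
  as a conditional on two inequalities it becomes routine.\<close>

lemma indicator_Icc_measurable:
  fixes u v :: "'a \<Rightarrow> real"
  assumes [measurable]: "u \<in> borel_measurable M" "v \<in> borel_measurable M"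
  shows "(\<lambda>x. indicator {0..u x} (v x) :: real) \<in> borel_measurable M"
proof -
  have "(\<lambda>x. indicator {0..u x} (v x) :: real) = (\<lambda>x. if 0 \<le> v x \<and> v x \<le> u x then 1 else 0)"
    by (auto simp: indicator_def)
  then show ?thesis by simp
qed

lemma indicator_Icc_measurable_ennreal:
  fixes u v :: "'a \<Rightarrow> real"
  assumes [measurable]: "u \<in> borel_measurable M" "v \<in> borel_measurable M"
  shows "(\<lambda>x. indicator {0..u x} (v x) :: ennreal) \<in> borel_measurable M"
proof -
  have "(\<lambda>x. indicator {0..u x} (v x) :: ennreal) = (\<lambda>x. if 0 \<le> v x \<and> v x \<le> u x then 1 else 0)"
    by (auto simp: indicator_def)
  then show ?thesis by simp
qed

text \<open>The bridge between the real-valued integrals of the recurrence and nonnegative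
  integrals, where Tonelli needs no integrability. A bounded integrand on a bounded interval makes
  the passage legitimate.\<close>

lemma set_integral_bounded_nn_integral:
  fixes u :: "real \<Rightarrow> real"
  assumes [measurable]: "u \<in> borel_measurable borel" and "\<And>x. 0 \<le> u x" "\<And>x. u x \<le> C"
  shows "set_integrable lborel {a..b} u"
    "ennreal (LINT x:{a..b}|lborel. u x) = (\<integral>\<^sup>+x. ennreal (u x) * indicator {a..b} x \<partial>lborel)"
proof -
  show 1: "set_integrable lborel {a..b} u"
    unfolding set_integrable_def
  proof (rule Bochner_Integration.integrable_bound)
    show "integrable lborel (\<lambda>x. C * indicator {a..b} x)"
      by (intro integrable_mult_right integrable_real_indicator) (auto simp: emeasure_lborel_Icc_eq)
    show "AE x in lborel. norm (indicator {a..b} x *\<^sub>R u x) \<le> norm (C * indicator {a..b} x)"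
      using assms by (auto simp: indicator_def intro!: AE_I2) (smt (verit))
  qed simp
  show "ennreal (LINT x:{a..b}|lborel. u x) = (\<integral>\<^sup>+x. ennreal (u x) * indicator {a..b} x \<partial>lborel)"
    unfolding set_lebesgue_integral_def
    by (subst nn_integral_eq_integral[symmetric])
      (use 1 assms in \<open>auto simp: set_integrable_def indicator_def intro!: nn_integral_cong\<close>)
qed

lemma nn_integral_add_shift:
  fixes u :: "real \<Rightarrow> ennreal"
  assumes "u \<in> borel_measurable borel"
  shows "(\<integral>\<^sup>+x. u (x + t) \<partial>lborel) = (\<integral>\<^sup>+x. u x \<partial>lborel)"
  using nn_integral_real_affine[of u 1 t] assms by (simp add: add.commute)

section \<open>The recurrence step preserves the invariant\<close>

lemma ennreal_pdf_step:
  assumes f: "nice_density f" and h: "nice_joint n h"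
  shows "ennreal (pdf_step f h y z) =
    ennreal (f z) * (\<integral>\<^sup>+x. ennreal (h (y - z) x) * indicator {0..z} x \<partial>lborel) +
    (\<integral>\<^sup>+x. ennreal (f x) * ennreal (h (y - x) z) * indicator {0..z} x \<partial>lborel)"
proof -
  note [measurable] = nice_density_measurable[OF f] nice_joint_measurable2[OF h]
  obtain B where B: "\<And>x. f x \<le> B" "0 \<le> B" using nice_density_bound[OF f] by blast
  obtain C where C: "\<And>y z. h y z \<le> C" "0 \<le> C" using nice_joint_bound[OF h] by blast
  have nn: "0 \<le> f x" "0 \<le> h x y" for x y using nice_densityD(2)[OF f] nice_jointD(2)[OF h] by auto
  have 1: "ennreal (LINT x:{0..z}|lborel. h (y - z) x) = (\<integral>\<^sup>+x. ennreal (h (y - z) x) * indicator {0..z} x \<partial>lborel)"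
    by (rule set_integral_bounded_nn_integral(2)[of _ C]) (use C nn in auto)
  have 2: "ennreal (LINT x:{0..z}|lborel. f x * h (y - x) z) =
      (\<integral>\<^sup>+x. ennreal (f x * h (y - x) z) * indicator {0..z} x \<partial>lborel)"
    by (rule set_integral_bounded_nn_integral(2)[of _ "B * C"]) (use B C nn in \<open>auto intro!: mult_mono\<close>)
  have "0 \<le> (LINT x:{0..z}|lborel. h (y - z) x)" "0 \<le> (LINT x:{0..z}|lborel. f x * h (y - x) z)"
    unfolding set_lebesgue_integral_def by (intro Bochner_Integration.integral_nonneg; simp add: nn)+
  then show ?thesis
    unfolding pdf_step_def by (simp add: ennreal_plus ennreal_mult nn 1 2)
qed

lemma pdf_step_nonneg:
  assumes f: "nice_density f" and h: "nice_joint n h"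
  shows "0 \<le> pdf_step f h y z"
  unfolding pdf_step_def set_lebesgue_integral_def
  by (intro add_nonneg_nonneg mult_nonneg_nonneg Bochner_Integration.integral_nonneg)
    (simp_all add: nice_densityD[OF f] nice_jointD[OF h])

lemma pdf_step_measurable:
  assumes f: "nice_density f" and h: "nice_joint n h"
  shows "(\<lambda>p. pdf_step f h (fst p) (snd p)) \<in> borel_measurable borel"
proof -
  note [measurable] = nice_density_measurable[OF f] nice_joint_measurable2[OF h] indicator_Icc_measurable
  show ?thesis
    unfolding pdf_step_def set_lebesgue_integral_def borel_prod[symmetric]
    by measurable
qed

text \<open>Let \<open>0 \<le> x \<le> z\<close>. If \<open>(y - z, x)\<close> lies in
  \<open>D n\<close>, then \<open>0 \<le> y - z \<le> n * x \<le> n * z\<close>; if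
  \<open>(y - x, z)\<close> does, then \<open>z + x \<le> y \<le> n * z + x\<close>. Either way
  \<open>z \<le> y \<le> (n + 1) * z\<close>, so outside \<open>D (Suc n)\<close> both integrands
  vanish.\<close>

lemma pdf_step_outside_D:
  assumes f: "nice_density f" and h: "nice_joint n h" and n: "(y, z) \<notin> D (Suc n)"
  shows "pdf_step f h y z = 0"
proof -
  have 1: "indicator {0..z} x *\<^sub>R h (y - z) x = 0" for x
  proof -
    have "h (y - z) x = 0" if "0 \<le> x" "x \<le> z"
    proof (rule nice_jointD(3)[OF h])
      have "real n * x \<le> real n * z" using that by (intro mult_left_mono) auto
      then show "(y - z, x) \<notin> D n" using that n by (auto simp: D_def algebra_simps)
    qed
    then show ?thesis by (auto simp: indicator_def)
  qed
  have 2: "indicator {0..z} x *\<^sub>R (f x * h (y - x) z) = 0" for x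
  proof -
    have "h (y - x) z = 0" if "0 \<le> x" "x \<le> z"
      by (rule nice_jointD(3)[OF h]) (use that n in \<open>auto simp: D_def algebra_simps\<close>)
    then show ?thesis by (auto simp: indicator_def)
  qed
  show ?thesis unfolding pdf_step_def set_lebesgue_integral_def 1 2 by simp
qed

text \<open>For almost every \<open>w\<close>, \<open>h\<close> is continuous at almost every point
  of the line over \<open>w\<close>. Pulling back along \<open>w = y - z\<close> keeps the
  exceptional set null, and joint continuity of \<open>h\<close> passes to the composition.\<close>

lemma isCont_shear_first_section:
  assumes h: "nice_joint n h"
  shows "AE p in (lborel :: (real \<times> real) measure). AE x in lborel. isCont (\<lambda>p. h (fst p - snd p) x) p"
proof -
  have "AE w in lborel. AE x in lborel. isCont (\<lambda>p. h (fst p) (snd p)) (w, x)"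
    using lborel2_AE_sections(1)[OF nice_jointD(4)[OF h]] .
  from lborel2_AE_linear[OF this, of 1 "-1"]
  have "AE p in (lborel :: (real \<times> real) measure). AE x in lborel.
      isCont (\<lambda>p. h (fst p) (snd p)) (fst p - snd p, x)" by simp
  then show ?thesis
  proof eventually_elim
    case (elim p)
    then show ?case
    proof eventually_elim
      case (elim x)
      have "isCont (\<lambda>p. (fst p - snd p, x)) p"
        by (intro continuous_intros)
      from isCont_o2[OF this, of "\<lambda>p. h (fst p) (snd p)"] elim show ?case by simp
    qed
  qed
qed

text \<open>The counterpart for lines at fixed height \<open>z\<close>, with the reflection
  \<open>x \<mapsto> y - x\<close> preserving null sets.\<close>

lemma isCont_shear_second_section:
  assumes h: "nice_joint n h"
  shows "AE p in (lborel :: (real \<times> real) measure). AE x in lborel. isCont (\<lambda>p. h (fst p - x) (snd p)) p"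
proof -
  have "AE z in lborel. AE y in lborel. isCont (\<lambda>p. h (fst p) (snd p)) (y, z)"
    using lborel2_AE_sections(2)[OF nice_jointD(4)[OF h]] .
  from lborel2_AE_linear[OF this, of 0 1]
  have "AE p in (lborel :: (real \<times> real) measure). AE y in lborel.
      isCont (\<lambda>p. h (fst p) (snd p)) (y, snd p)" by simp
  then show ?thesis
  proof eventually_elim
    case (elim p)
    from lborel_AE_affine[OF this, of "-1" "fst p"]
    have "AE x in lborel. isCont (\<lambda>p. h (fst p) (snd p)) (fst p - x, snd p)" by simp
    then show ?case
    proof eventually_elim
      case (elim x)
      have "isCont (\<lambda>p. (fst p - x, snd p)) p"
        by (intro continuous_intros)
      from isCont_o2[OF this, of "\<lambda>p. h (fst p) (snd p)"] elim show ?case by simp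
    qed
  qed
qed

lemma pdf_step_AE_isCont:
  assumes f: "nice_density f" and h: "nice_joint n h"
  shows "AE p in lborel. isCont (\<lambda>p. pdf_step f h (fst p) (snd p)) p"
proof -
  note [measurable] = nice_density_measurable[OF f] nice_joint_measurable2[OF h]
  obtain C where C: "\<And>y z. h y z \<le> C" "0 \<le> C" using nice_joint_bound[OF h] by blast
  have nn: "0 \<le> f x" "0 \<le> h x y" for x y using nice_densityD(2)[OF f] nice_jointD(2)[OF h] by auto
  have "AE p in (lborel :: (real \<times> real) measure). isCont f (snd p)"
    using lborel2_AE_linear[OF nice_densityD(5)[OF f], of 0 1] by simp
  with isCont_shear_first_section[OF h] isCont_shear_second_section[OF h]
  show ?thesis
  proof eventually_elim
    case (elim p)
    have ne: "AE x in lborel. x \<noteq> snd p"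
      by (rule AE_lborel_singleton)
    have i1: "isCont (\<lambda>p. LINT x:{0..snd p}|lborel. h (fst p - snd p) x) p"
      unfolding set_lebesgue_integral_def
    proof (rule isCont_lebesgue_integral)
      \<comment> \<open>The majorant has to serve all \<open>q\<close> near \<open>p\<close>, so the
        interval is lengthened by 1, and only points with \<open>snd q < snd p + 1\<close> are
        considered.\<close>
      show "integrable lborel (\<lambda>x. C * indicator {0..snd p + 1} x)"
        by (intro integrable_mult_right integrable_real_indicator) (auto simp: emeasure_lborel_Icc_eq)
      show "AE x in lborel. isCont (\<lambda>p. indicator {0..snd p} x *\<^sub>R h (fst p - snd p) x) p"
        using elim(1) ne
        by eventually_elim (intro continuous_intros isCont_indicator_Icc, auto)
      have "eventually (\<lambda>q. snd q < snd p + 1) (nhds p)"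
        by (intro order_tendstoD(2)[of snd "snd p"] tendsto_snd[OF filterlim_ident, unfolded]) (auto)
      then show "\<forall>\<^sub>F q in nhds p. AE x in lborel.
          norm (indicator {0..snd q} x *\<^sub>R h (fst q - snd q) x) \<le> C * indicator {0..snd p + 1} x"
        by eventually_elim (use C nn in \<open>auto simp: indicator_def\<close>)
    qed simp
    have i2: "isCont (\<lambda>p. LINT x:{0..snd p}|lborel. f x * h (fst p - x) (snd p)) p"
      unfolding set_lebesgue_integral_def
    proof (rule isCont_lebesgue_integral)
      show "integrable lborel (\<lambda>x. C * f x)" using nice_density_integrable[OF f] by simp
      show "AE x in lborel. isCont (\<lambda>p. indicator {0..snd p} x *\<^sub>R (f x * h (fst p - x) (snd p))) p"
        using elim(2) ne
        by eventually_elim (intro continuous_intros isCont_indicator_Icc, auto)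
      show "\<forall>\<^sub>F q in nhds p. AE x in lborel.
          norm (indicator {0..snd q} x *\<^sub>R (f x * h (fst q - x) (snd q))) \<le> C * f x"
        by (intro always_eventually allI AE_I2)
          (use C nn in \<open>auto simp: indicator_def mult.commute[of C] intro!: mult_left_mono\<close>)
    qed simp
    have "isCont (\<lambda>p. f (snd p)) p"
      by (rule isCont_o2[where f = snd and g = f]) (use elim(3) in \<open>auto intro!: continuous_intros\<close>)
    then show ?case
      unfolding pdf_step_def by (intro continuous_intros i1 i2)
  qed
qed

lemma pdf_step_bounded:
  assumes f: "nice_density f" and h: "nice_joint n h"
  shows "\<exists>C. \<forall>y z. pdf_step f h y z \<le> C"
proof -
  note [measurable] = nice_density_measurable[OF f] nice_joint_measurable2[OF h]
  obtain B where B: "\<And>x. f x \<le> B" "0 \<le> B" using nice_density_bound[OF f] by blast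
  obtain C where C: "\<And>y z. h y z \<le> C" "0 \<le> C" using nice_joint_bound[OF h] by blast
  obtain Q where Q: "\<And>w. (\<integral>\<^sup>+x. ennreal (h w x) \<partial>lborel) \<le> ennreal Q" "0 \<le> Q"
    using nice_joint_marginal_bound[OF h] by blast
  \<comment> \<open>The second summand integrates values at most \<open>C\<close> against the
    probability density \<open>f\<close>, so it contributes \<open>C\<close> regardless of the
    length of \<open>{0..z}\<close>.\<close>
  have "pdf_step f h y z \<le> B * Q + C" for y z
  proof -
    have 1: "(\<integral>\<^sup>+x. ennreal (h (y - z) x) * indicator {0..z} x \<partial>lborel) \<le> ennreal Q"
      by (rule order_trans[OF nn_integral_mono Q(1)[of "y - z"]]) (auto simp: indicator_def)
    have "(\<integral>\<^sup>+x. ennreal (f x) * ennreal (h (y - x) z) * indicator {0..z} x \<partial>lborel)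
        \<le> (\<integral>\<^sup>+x. ennreal (f x) * ennreal C \<partial>lborel)"
      by (rule nn_integral_mono) (use C in \<open>auto simp: indicator_def intro!: mult_left_mono ennreal_leI\<close>)
    also have "\<dots> = ennreal C"
      by (simp add: nn_integral_multc nice_densityD[OF f])
    finally have "ennreal (pdf_step f h y z) \<le> ennreal B * ennreal Q + ennreal C"
      unfolding ennreal_pdf_step[OF f h]
      by (intro add_mono mult_mono 1 ennreal_leI B) auto
    also have "\<dots> = ennreal (B * Q + C)" using B C Q by (simp add: ennreal_mult ennreal_plus)
    finally show ?thesis using B C Q by (subst (asm) ennreal_le_iff) auto
  qed
  then show ?thesis by blast
qed

text \<open>The marginal in the first coordinate is a convolution, so its bound propagates.\<close>

lemma pdf_step_marginal_bound:
  assumes f: "nice_density f" and h: "nice_joint n h"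
  shows "\<exists>Q. \<forall>w. (\<integral>\<^sup>+x. ennreal (pdf_step f h w x) \<partial>lborel) \<le> ennreal Q"
proof -
  note [measurable] = nice_density_measurable[OF f] nice_joint_measurable2[OF h] indicator_Icc_measurable_ennreal
  obtain Q where Q: "\<And>w. (\<integral>\<^sup>+x. ennreal (h w x) \<partial>lborel) \<le> ennreal Q" "0 \<le> Q"
    using nice_joint_marginal_bound[OF h] by blast
  \<comment> \<open>Each summand is estimated by \<open>Q\<close> after dropping its cut-off. Their
    sum is a single convolution bounded by \<open>Q\<close>, but only finiteness matters
    here.\<close>
  have "(\<integral>\<^sup>+x. ennreal (pdf_step f h w x) \<partial>lborel) \<le> ennreal (Q + Q)" for w
  proof -
    have 1: "(\<integral>\<^sup>+z. ennreal (f z) * (\<integral>\<^sup>+x. ennreal (h (w - z) x) * indicator {0..z} x \<partial>lborel) \<partial>lborel)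
       \<le> (\<integral>\<^sup>+z. ennreal (f z) * ennreal Q \<partial>lborel)"
      by (intro nn_integral_mono mult_left_mono order_trans[OF nn_integral_mono Q(1)])
        (auto simp: indicator_def)
    have "(\<integral>\<^sup>+z. (\<integral>\<^sup>+x. ennreal (f x) * ennreal (h (w - x) z) * indicator {0..z} x \<partial>lborel) \<partial>lborel)
      = (\<integral>\<^sup>+x. (\<integral>\<^sup>+z. ennreal (f x) * ennreal (h (w - x) z) * indicator {0..z} x \<partial>lborel) \<partial>lborel)"
      by (rule lborel_pair.Fubini') measurable
    also have "\<dots> \<le> (\<integral>\<^sup>+x. (\<integral>\<^sup>+z. ennreal (f x) * ennreal (h (w - x) z) \<partial>lborel) \<partial>lborel)"
      by (intro nn_integral_mono) (auto simp: indicator_def)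
    also have "\<dots> = (\<integral>\<^sup>+x. ennreal (f x) * (\<integral>\<^sup>+z. ennreal (h (w - x) z) \<partial>lborel) \<partial>lborel)"
      by (simp add: nn_integral_cmult)
    also have "\<dots> \<le> (\<integral>\<^sup>+z. ennreal (f z) * ennreal Q \<partial>lborel)"
      by (intro nn_integral_mono mult_left_mono Q) auto
    finally have 2: "(\<integral>\<^sup>+z. (\<integral>\<^sup>+x. ennreal (f x) * ennreal (h (w - x) z) * indicator {0..z} x \<partial>lborel) \<partial>lborel)
       \<le> (\<integral>\<^sup>+z. ennreal (f z) * ennreal Q \<partial>lborel)" .
    have 3: "(\<integral>\<^sup>+z. ennreal (f z) * ennreal Q \<partial>lborel) = ennreal Q"
      by (simp add: nn_integral_multc nice_densityD[OF f])
    have "(\<integral>\<^sup>+z. ennreal (pdf_step f h w z) \<partial>lborel) =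
      (\<integral>\<^sup>+z. ennreal (f z) * (\<integral>\<^sup>+x. ennreal (h (w - z) x) * indicator {0..z} x \<partial>lborel) \<partial>lborel) +
      (\<integral>\<^sup>+z. (\<integral>\<^sup>+x. ennreal (f x) * ennreal (h (w - x) z) * indicator {0..z} x \<partial>lborel) \<partial>lborel)"
      unfolding ennreal_pdf_step[OF f h] by (rule nn_integral_add) measurable
    also have "\<dots> \<le> ennreal Q + ennreal Q" using 1 2 3 by (intro add_mono) auto
    finally show ?thesis using Q(2) by (subst ennreal_plus) auto
  qed
  then show ?thesis by blast
qed

lemma nice_joint_pdf_step:
  assumes f: "nice_density f" and h: "nice_joint n h"
  shows "nice_joint (Suc n) (pdf_step f h)"
  unfolding nice_joint_def
  using pdf_step_measurable[OF f h] pdf_step_nonneg[OF f h] pdf_step_outside_D[OF f h] pdf_step_bounded[OF f h]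
    pdf_step_marginal_bound[OF f h] pdf_step_AE_isCont[OF f h] by blast

section \<open>The base case of two variables\<close>

lemma nice_joint_pdf_two:
  assumes f1: "nice_density f1" and f2: "nice_density f2"
  shows "nice_joint 2 (pdf_two f1 f2)"
proof -
  note [measurable] = nice_density_measurable[OF f1] nice_density_measurable[OF f2]
  obtain B1 where B1: "\<And>x. f1 x \<le> B1" "0 \<le> B1" using nice_density_bound[OF f1] by blast
  obtain B2 where B2: "\<And>x. f2 x \<le> B2" "0 \<le> B2" using nice_density_bound[OF f2] by blast
  note nn = nice_densityD(2)[OF f1] nice_densityD(2)[OF f2]
  have "(\<lambda>p. pdf_two f1 f2 (fst p) (snd p)) \<in> borel_measurable (borel \<Otimes>\<^sub>M borel)"
    unfolding pdf_two_def D_def by measurable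
  moreover have "pdf_two f1 f2 y z \<le> B2 * B1 + B2 * B1" for y z
  proof -
    have "f2 z * f1 (y - z) + f2 (y - z) * f1 z \<le> B2 * B1 + B2 * B1"
      by (intro add_mono mult_mono B1 B2 nn)
    then show ?thesis using B1(2) B2(2) by (simp add: pdf_two_def)
  qed
  \<comment> \<open>In each product the factor at \<open>w - z\<close> is replaced by its supremum;
    the factor at \<open>z\<close> is a density and integrates to 1.\<close>
  moreover have "(\<integral>\<^sup>+z. ennreal (pdf_two f1 f2 w z) \<partial>lborel) \<le> ennreal (B1 + B2)" for w
  proof -
    have "(\<integral>\<^sup>+z. ennreal (pdf_two f1 f2 w z) \<partial>lborel) \<le>
        (\<integral>\<^sup>+z. ennreal (f2 z) * ennreal B1 + ennreal B2 * ennreal (f1 z) \<partial>lborel)"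
      using B1 B2 nn
      by (intro nn_integral_mono)
        (auto simp: pdf_two_def simp flip: ennreal_mult ennreal_plus intro!: ennreal_leI add_mono mult_mono)
    also have "\<dots> = ennreal B1 + ennreal B2"
      by (simp add: nn_integral_add nn_integral_cmult nn_integral_multc nice_densityD[OF f1] nice_densityD[OF f2])
    finally show ?thesis using B1 B2 by (simp add: ennreal_plus)
  qed
  moreover have "AE p in lborel. isCont (\<lambda>p. pdf_two f1 f2 (fst p) (snd p)) p"
  proof -
    have *: "AE p in (lborel :: (real \<times> real) measure). isCont f (fst p - snd p)" 
      "AE p in (lborel :: (real \<times> real) measure). isCont f (snd p)" if "nice_density f" for f
      using lborel2_AE_linear[OF nice_densityD(5)[OF that], of 1 "-1"]
        lborel2_AE_linear[OF nice_densityD(5)[OF that], of 0 1] by auto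
    from *[OF f1] *[OF f2] lborel2_AE_D_boundary[of "real 2"] show ?thesis
    proof eventually_elim
      case (elim p)
      have e: "pdf_two f1 f2 (fst p) (snd p) =
        indicator (D 2) p * (f2 (snd p) * f1 (fst p - snd p) + f2 (fst p - snd p) * f1 (snd p))" for p
        by (simp add: pdf_two_def indicator_def)
      have c: "isCont (\<lambda>p. fst p - snd p) p" "isCont snd p"
        by (auto intro!: continuous_intros)
      show ?case
        unfolding e using elim
        by (intro continuous_intros isCont_indicator_D isCont_o2[OF c(1)] isCont_o2[OF c(2)]) auto
    qed
  qed
  moreover have "0 \<le> pdf_two f1 f2 y z" "(y, z) \<notin> D 2 \<longrightarrow> pdf_two f1 f2 y z = 0" for y z
    by (auto simp: pdf_two_def nn)
  ultimately show ?thesis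
    unfolding nice_joint_def borel_prod[symmetric] by blast
qed

section \<open>Effect of the recurrence on expectations of test functions\<close>

text \<open>The part \<open>u \<le> x\<close> has maximum \<open>x\<close> and the part
  \<open>x < u\<close> has maximum \<open>u\<close>. In each part the maximum becomes the outer
  variable \<open>z\<close>, and the other variable is translated into the sum
  \<open>y\<close>.\<close>

lemma pdf_two_law:
  fixes \<phi> :: "real \<Rightarrow> real \<Rightarrow> ennreal"
  assumes f1: "nice_density f1" and f2: "nice_density f2" and \<phi>: "case_prod \<phi> \<in> borel_measurable (borel \<Otimes>\<^sub>M borel)"
  shows "(\<integral>\<^sup>+x. ennreal (f2 x) * (\<integral>\<^sup>+u. ennreal (f1 u) * \<phi> (u + x) (max u x) \<partial>lborel) \<partial>lborel) =
    (\<integral>\<^sup>+p. ennreal (pdf_two f1 f2 (fst p) (snd p)) * \<phi> (fst p) (snd p) \<partial>lborel)"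
proof -
  have [measurable]: "(\<lambda>x. \<phi> (u x) (v x)) \<in> borel_measurable M"
    if "u \<in> borel_measurable M" "v \<in> borel_measurable M" for u v and M :: "'b measure"
    using measurable_compose[OF measurable_Pair[OF that] \<phi>] by simp
  note [measurable] = nice_density_measurable[OF f1] nice_density_measurable[OF f2]
  note nn = nice_densityD(2)[OF f1] nice_densityD(2)[OF f2]
  let ?A = "\<lambda>y z. ennreal (f2 z) * ennreal (f1 (y - z)) * \<phi> y z * (if y \<le> 2 * z then 1 else 0)"
  let ?B = "\<lambda>y z. ennreal (f2 (y - z)) * ennreal (f1 z) * \<phi> y z * (if y < 2 * z then 1 else 0)"
  let ?L1 = "\<lambda>x u. ennreal (f2 x) * ennreal (f1 u) * \<phi> (u + x) x * (if u \<le> x then 1 else 0)"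
  let ?L2 = "\<lambda>x u. ennreal (f2 x) * ennreal (f1 u) * \<phi> (u + x) u * (if x < u then 1 else 0)"
  have "(\<integral>\<^sup>+x. ennreal (f2 x) * (\<integral>\<^sup>+u. ennreal (f1 u) * \<phi> (u + x) (max u x) \<partial>lborel) \<partial>lborel) =
     (\<integral>\<^sup>+x. \<integral>\<^sup>+u. ?L1 x u + ?L2 x u \<partial>lborel \<partial>lborel)"
    by (subst nn_integral_cmult[symmetric])
      (auto intro!: nn_integral_cong simp: max_def mult.assoc)
  also have "\<dots> = (\<integral>\<^sup>+x. \<integral>\<^sup>+u. ?L1 x u \<partial>lborel \<partial>lborel) + (\<integral>\<^sup>+x. \<integral>\<^sup>+u. ?L2 x u \<partial>lborel \<partial>lborel)"
    by (simp add: nn_integral_add)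
  also have "(\<integral>\<^sup>+x. \<integral>\<^sup>+u. ?L1 x u \<partial>lborel \<partial>lborel) = (\<integral>\<^sup>+z. \<integral>\<^sup>+y. ?A y z \<partial>lborel \<partial>lborel)"
  proof (rule nn_integral_cong)
    fix x
    show "(\<integral>\<^sup>+u. ?L1 x u \<partial>lborel) = (\<integral>\<^sup>+y. ?A y x \<partial>lborel)"
      by (subst nn_integral_add_shift[where t = x, symmetric]) (auto intro!: nn_integral_cong)
  qed
  also have "(\<integral>\<^sup>+x. \<integral>\<^sup>+u. ?L2 x u \<partial>lborel \<partial>lborel) = (\<integral>\<^sup>+u. \<integral>\<^sup>+x. ?L2 x u \<partial>lborel \<partial>lborel)"
    by (rule lborel_pair.Fubini'[symmetric]) measurable
  also have "\<dots> = (\<integral>\<^sup>+z. \<integral>\<^sup>+y. ?B y z \<partial>lborel \<partial>lborel)"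
  proof (rule nn_integral_cong)
    fix u
    show "(\<integral>\<^sup>+x. ?L2 x u \<partial>lborel) = (\<integral>\<^sup>+y. ?B y u \<partial>lborel)"
      by (subst nn_integral_add_shift[where t = u, symmetric]) (auto intro!: nn_integral_cong simp: add.commute)
  qed
  also have "(\<integral>\<^sup>+z. \<integral>\<^sup>+y. ?A y z \<partial>lborel \<partial>lborel) + (\<integral>\<^sup>+z. \<integral>\<^sup>+y. ?B y z \<partial>lborel \<partial>lborel) =
     (\<integral>\<^sup>+z. \<integral>\<^sup>+y. ?A y z + ?B y z \<partial>lborel \<partial>lborel)"
    by (simp add: nn_integral_add)
  also have "\<dots> = (\<integral>\<^sup>+z. \<integral>\<^sup>+y. ennreal (pdf_two f1 f2 y z) * \<phi> y z \<partial>lborel \<partial>lborel)"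
  proof (rule nn_integral_cong)
    fix z :: real
    \<comment> \<open>At \<open>y = 2 * z\<close> the two variables tie: \<open>pdf_two\<close>
      counts both summands there, whereas \<open>?A + ?B\<close> counts only the first. For fixed
      \<open>z\<close> this is one point.\<close>
    have "AE y in lborel. y \<noteq> 2 * z" by (rule AE_lborel_singleton)
    then have "AE y in lborel. ?A y z + ?B y z = ennreal (pdf_two f1 f2 y z) * \<phi> y z"
    proof eventually_elim
      case (elim y)
      show ?case
      \<comment> \<open>For \<open>y < z\<close> the argument \<open>y - z\<close> is negative and
        both densities vanish there. Otherwise \<open>y \<le> 2 * z\<close> forces
        \<open>z \<ge> 0\<close>, which is membership in \<open>D 2\<close>.\<close>
      proof (cases "y < z")
        case True
        then show ?thesis using nice_densityD(3)[OF f1, of "y - z"] nice_densityD(3)[OF f2, of "y - z"]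
          by (simp add: pdf_two_def D_def)
      next
        case False
        then show ?thesis using elim nn
          by (auto simp: pdf_two_def D_def ennreal_mult ennreal_plus distrib_right)
      qed
    qed
    then show "(\<integral>\<^sup>+y. ?A y z + ?B y z \<partial>lborel) = (\<integral>\<^sup>+y. ennreal (pdf_two f1 f2 y z) * \<phi> y z \<partial>lborel)"
      by (rule nn_integral_cong_AE)
  qed
  also have "\<dots> = (\<integral>\<^sup>+p. ennreal (pdf_two f1 f2 (fst p) (snd p)) * \<phi> (fst p) (snd p) \<partial>(lborel \<Otimes>\<^sub>M lborel))"
  proof -
    note [measurable] = nice_joint_measurable2[OF nice_joint_pdf_two[OF f1 f2]]
    show ?thesis
      by (subst lborel_pair.nn_integral_snd[symmetric]) auto
  qed
  finally show ?thesis by (simp only: lborel_prod)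
qed

text \<open>Integrating out \<open>x\<close> gives the new law as a triple integral. In
  \<open>?L1\<close> the new variable \<open>x\<close> is the maximum and the old \<open>z\<close>
  is integrated away; in \<open>?L2\<close> the old \<open>z\<close> stays the maximum and
  \<open>x\<close> is integrated away. These are the two summands of
  \<open>pdf_step\<close>.\<close>

lemma pdf_step_law:
  fixes \<phi> :: "real \<Rightarrow> real \<Rightarrow> ennreal"
  assumes f: "nice_density f" and h: "nice_joint n h" and \<phi>: "case_prod \<phi> \<in> borel_measurable (borel \<Otimes>\<^sub>M borel)"
  shows "(\<integral>\<^sup>+x. ennreal (f x) * (\<integral>\<^sup>+p. ennreal (h (fst p) (snd p)) * \<phi> (fst p + x) (max (snd p) x) \<partial>lborel) \<partial>lborel) =
    (\<integral>\<^sup>+p. ennreal (pdf_step f h (fst p) (snd p)) * \<phi> (fst p) (snd p) \<partial>lborel)"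
proof -
  have [measurable]: "(\<lambda>x. \<phi> (u x) (v x)) \<in> borel_measurable M"
    if "u \<in> borel_measurable M" "v \<in> borel_measurable M" for u v and M :: "'b measure"
    using measurable_compose[OF measurable_Pair[OF that] \<phi>] by simp
  note [measurable] = nice_density_measurable[OF f] nice_joint_measurable2[OF h] nice_joint_measurable2[OF nice_joint_pdf_step[OF f h]]
    indicator_Icc_measurable_ennreal
  let ?L1 = "\<lambda>x y z. ennreal (f x) * ennreal (h y z) * \<phi> (y + x) x * indicator {0..x} z"
  let ?L2 = "\<lambda>x y z. ennreal (f x) * ennreal (h y z) * \<phi> (y + x) z * (if 0 \<le> x \<and> x < z then 1 else 0)"
  let ?A = "\<lambda>y z x. ennreal (f z) * ennreal (h (y - z) x) * \<phi> y z * indicator {0..z} x"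
  let ?B = "\<lambda>y z x. ennreal (f x) * ennreal (h (y - x) z) * \<phi> y z * indicator {0..z} x"
  have "(\<integral>\<^sup>+x. ennreal (f x) * (\<integral>\<^sup>+p. ennreal (h (fst p) (snd p)) * \<phi> (fst p + x) (max (snd p) x) \<partial>lborel) \<partial>lborel) =
    (\<integral>\<^sup>+x. ennreal (f x) * (\<integral>\<^sup>+y. \<integral>\<^sup>+z. ennreal (h y z) * \<phi> (y + x) (max z x) \<partial>lborel \<partial>lborel) \<partial>lborel)"
    unfolding lborel_prod[symmetric] by (subst lborel.nn_integral_fst[symmetric]) auto
  also have "\<dots> = (\<integral>\<^sup>+x. \<integral>\<^sup>+y. \<integral>\<^sup>+z. ennreal (f x) * (ennreal (h y z) * \<phi> (y + x) (max z x)) \<partial>lborel \<partial>lborel \<partial>lborel)"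
    by (simp add: nn_integral_cmult)
  also have "\<dots> = (\<integral>\<^sup>+x. \<integral>\<^sup>+y. \<integral>\<^sup>+z. ?L1 x y z + ?L2 x y z \<partial>lborel \<partial>lborel \<partial>lborel)"
  proof (intro nn_integral_cong)
    fix x y z :: real
    \<comment> \<open>The lower cut-offs at 0 in \<open>?L1\<close> and \<open>?L2\<close> lose
      nothing: \<open>h\<close> vanishes for negative \<open>z\<close> and \<open>f\<close> for
      negative \<open>x\<close>.\<close>
    have "h y z = 0" if "z < 0" using that nice_jointD(3)[OF h] by (auto simp: D_def)
    then show "ennreal (f x) * (ennreal (h y z) * \<phi> (y + x) (max z x)) = ?L1 x y z + ?L2 x y z"
      using nice_densityD(3)[OF f, of x]
      by (cases "x < 0"; cases "z < 0") (auto simp: max_def indicator_def mult.assoc)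
  qed
  also have "\<dots> = (\<integral>\<^sup>+x. \<integral>\<^sup>+y. \<integral>\<^sup>+z. ?L1 x y z \<partial>lborel \<partial>lborel \<partial>lborel) +
      (\<integral>\<^sup>+x. \<integral>\<^sup>+y. \<integral>\<^sup>+z. ?L2 x y z \<partial>lborel \<partial>lborel \<partial>lborel)"
    by (simp add: nn_integral_add)
  also have "(\<integral>\<^sup>+x. \<integral>\<^sup>+y. \<integral>\<^sup>+z. ?L1 x y z \<partial>lborel \<partial>lborel \<partial>lborel) =
     (\<integral>\<^sup>+z. \<integral>\<^sup>+y. \<integral>\<^sup>+x. ?A y z x \<partial>lborel \<partial>lborel \<partial>lborel)"
  proof (rule nn_integral_cong)
    fix x
    show "(\<integral>\<^sup>+y. \<integral>\<^sup>+z. ?L1 x y z \<partial>lborel \<partial>lborel) = (\<integral>\<^sup>+y. \<integral>\<^sup>+z. ?A y x z \<partial>lborel \<partial>lborel)"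
      by (subst nn_integral_add_shift[where t = x, symmetric]) (auto intro!: nn_integral_cong)
  qed
  \<comment> \<open>With \<open>y\<close> innermost, replacing \<open>y + x\<close> by
    \<open>y\<close> is a translation in one variable at fixed \<open>x\<close> and
    \<open>z\<close>; \<open>x\<close> is moved to the inside only afterwards.\<close>
  also have "(\<integral>\<^sup>+x. \<integral>\<^sup>+y. \<integral>\<^sup>+z. ?L2 x y z \<partial>lborel \<partial>lborel \<partial>lborel) =
     (\<integral>\<^sup>+x. \<integral>\<^sup>+z. \<integral>\<^sup>+y. ?L2 x y z \<partial>lborel \<partial>lborel \<partial>lborel)"
    by (intro nn_integral_cong lborel_pair.Fubini'[symmetric]) measurable
  also have "\<dots> = (\<integral>\<^sup>+x. \<integral>\<^sup>+z. \<integral>\<^sup>+y. ?B y z x \<partial>lborel \<partial>lborel \<partial>lborel)"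
  proof (rule nn_integral_cong)
    fix x :: real
    \<comment> \<open>The strict condition \<open>x < z\<close> of \<open>?L2\<close> and the closed
      interval \<open>{0..z}\<close> of \<open>?B\<close> differ only at the tie
      \<open>z = x\<close>.\<close>
    have "AE z in lborel. z \<noteq> x" by (rule AE_lborel_singleton)
    then show "(\<integral>\<^sup>+z. \<integral>\<^sup>+y. ?L2 x y z \<partial>lborel \<partial>lborel) = (\<integral>\<^sup>+z. \<integral>\<^sup>+y. ?B y z x \<partial>lborel \<partial>lborel)"
    proof (intro nn_integral_cong_AE, eventually_elim)
      case (elim z)
      then show "(\<integral>\<^sup>+y. ?L2 x y z \<partial>lborel) = (\<integral>\<^sup>+y. ?B y z x \<partial>lborel)"
        by (subst nn_integral_add_shift[where t = x, symmetric])
          (auto intro!: nn_integral_cong simp: indicator_def)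
    qed
  qed
  also have "\<dots> = (\<integral>\<^sup>+z. \<integral>\<^sup>+x. \<integral>\<^sup>+y. ?B y z x \<partial>lborel \<partial>lborel \<partial>lborel)"
    by (rule lborel_pair.Fubini'[symmetric]) measurable
  also have "\<dots> = (\<integral>\<^sup>+z. \<integral>\<^sup>+y. \<integral>\<^sup>+x. ?B y z x \<partial>lborel \<partial>lborel \<partial>lborel)"
    by (intro nn_integral_cong lborel_pair.Fubini'[symmetric]) measurable
  also have "(\<integral>\<^sup>+z. \<integral>\<^sup>+y. \<integral>\<^sup>+x. ?A y z x \<partial>lborel \<partial>lborel \<partial>lborel) + \<dots> =
     (\<integral>\<^sup>+z. \<integral>\<^sup>+y. (\<integral>\<^sup>+x. ?A y z x \<partial>lborel) + (\<integral>\<^sup>+x. ?B y z x \<partial>lborel) \<partial>lborel \<partial>lborel)"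
    by (simp add: nn_integral_add)
  also have "\<dots> = (\<integral>\<^sup>+z. \<integral>\<^sup>+y. ennreal (pdf_step f h y z) * \<phi> y z \<partial>lborel \<partial>lborel)"
  proof (intro nn_integral_cong)
    fix y z
    have A: "(\<integral>\<^sup>+x. ?A y z x \<partial>lborel) =
      ennreal (f z) * (\<integral>\<^sup>+x. ennreal (h (y - z) x) * indicator {0..z} x \<partial>lborel) * \<phi> y z"
      by (subst nn_integral_cmult[symmetric], simp, subst nn_integral_multc[symmetric], simp)
        (auto intro!: nn_integral_cong simp: ac_simps)
    have B: "(\<integral>\<^sup>+x. ?B y z x \<partial>lborel) =
      (\<integral>\<^sup>+x. ennreal (f x) * ennreal (h (y - x) z) * indicator {0..z} x \<partial>lborel) * \<phi> y z"
      by (subst nn_integral_multc[symmetric], simp)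
        (auto intro!: nn_integral_cong simp: ac_simps)
    show "(\<integral>\<^sup>+x. ?A y z x \<partial>lborel) + (\<integral>\<^sup>+x. ?B y z x \<partial>lborel) = ennreal (pdf_step f h y z) * \<phi> y z"
      unfolding A B ennreal_pdf_step[OF f h] by (simp add: distrib_right)
  qed
  also have "\<dots> = (\<integral>\<^sup>+p. ennreal (pdf_step f h (fst p) (snd p)) * \<phi> (fst p) (snd p) \<partial>(lborel \<Otimes>\<^sub>M lborel))"
    by (subst lborel_pair.nn_integral_snd[symmetric]) auto
  finally show ?thesis by (simp only: lborel_prod)
qed

section \<open>The recurrence as ordinary functions from level 2 on\<close>

text \<open>Index \<open>n\<close> stands for level \<open>n + 2\<close>, so the variable added in
  passing to \<open>Suc n\<close> has index \<open>n + 3\<close>.\<close>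

primrec regular_pdf :: "(nat \<Rightarrow> real \<Rightarrow> real) \<Rightarrow> nat \<Rightarrow> real \<Rightarrow> real \<Rightarrow> real" where
  "regular_pdf f 0 = pdf_two (f 1) (f 2)"
| "regular_pdf f (Suc n) = pdf_step (f (n + 3)) (regular_pdf f n)"

lemma nice_joint_regular_pdf:
  assumes "\<And>i. i \<ge> 1 \<Longrightarrow> nice_density (f i)"
  shows "nice_joint (n + 2) (regular_pdf f n)"
proof (induction n)
  case 0
  then show ?case using nice_joint_pdf_two[of "f 1" "f 2"] assms by (simp add: numeral_2_eq_2)
next
  case (Suc n)
  then show ?case using nice_joint_pdf_step[OF assms[of "n + 3"] Suc.IH] by simp
qed

lemma the_diff: "(THE s. y - s = z) = (y - z :: real)"
  by (rule the_equality) auto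

lemma the_eq_var: "(THE s. y = s) = y" "(THE s. s = y) = y"
  by auto

lemma joint_pdf_2: "joint_pdf f 2 = Regular (pdf_two (f 1) (f 2))"
proof -
  have "joint_pdf f (Suc (Suc 0)) = Regular (pdf_two (f 1) (f 2))"
    by (auto simp: fun_eq_iff pdf_two_def D_def Let_def the_diff the_eq_var numeral_2_eq_2)
  then show ?thesis by (simp add: numeral_2_eq_2)
qed

text \<open>The explicit restriction to \<open>D\<close> in \<open>joint_pdf\<close> agrees with the
  unrestricted \<open>pdf_step\<close> because the latter already vanishes outside.\<close>

lemma joint_pdf_regular:
  assumes nice_density: "\<And>i. i \<ge> 1 \<Longrightarrow> nice_density (f i)"
  shows "joint_pdf f (n + 2) = Regular (regular_pdf f n)"
proof (induction n)
  case 0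
  then show ?case using joint_pdf_2[of f] by (simp only: add_0 regular_pdf.simps)
next
  case (Suc n)
  have e: "f (Suc (Suc (Suc n))) = f (n + 3)" by (simp add: numeral_3_eq_3)
  have "pdf_step (f (n + 3)) (regular_pdf f n) y z = 0" if "(y, z) \<notin> D (Suc (Suc (Suc n)))" for y z
    using pdf_step_outside_D[OF nice_density[of "n + 3"] nice_joint_regular_pdf[of f n]] nice_density that by simp
  then have "joint_pdf f (Suc (Suc (Suc n))) = Regular (regular_pdf f (Suc n))"
    using Suc.IH by (simp add: fun_eq_iff pdf_step_def e del: One_nat_def)
  then show ?case by simp
qed

section \<open>The law of the sum and maximum of independent variables\<close>

locale independent_densities = prob_space M for M :: "'a measure" +
  fixes X :: "nat \<Rightarrow> 'a \<Rightarrow> real" and f :: "nat \<Rightarrow> real \<Rightarrow> real"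
  assumes indep: "indep_vars (\<lambda>_. borel) X {1..}"
    and dist: "\<And>i. 1 \<le> i \<Longrightarrow> distributed M lborel (X i) (\<lambda>x. ennreal (f i x))"
    and nice_density: "\<And>i. 1 \<le> i \<Longrightarrow> nice_density (f i)"
    and X_nonneg: "\<And>i. 1 \<le> i \<Longrightarrow> AE \<omega> in M. 0 \<le> X i \<omega>"
begin

lemma X_measurable [measurable]: "1 \<le> i \<Longrightarrow> X i \<in> borel_measurable M"
  using indep unfolding indep_vars_def by auto

lemma Y_measurable [measurable]: "Y X n \<in> borel_measurable M"
  unfolding Y_def[abs_def] by (rule borel_measurable_sum) auto

lemma Z_measurable [measurable]: "1 \<le> n \<Longrightarrow> Z X n \<in> borel_measurable M"
  unfolding Z_def[abs_def] by (rule borel_measurable_Max) auto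

lemma Y_1: "Y X 1 = X 1" and Z_1: "Z X 1 = X 1"
  by (auto simp: Y_def Z_def fun_eq_iff)

lemma Z_Suc: "1 \<le> n \<Longrightarrow> Z X (Suc n) \<omega> = max (Z X n \<omega>) (X (Suc n) \<omega>)"
proof -
  assume n: "1 \<le> n"
  have "(\<lambda>i. X i \<omega>) ` {1..Suc n} = insert (X (Suc n) \<omega>) ((\<lambda>i. X i \<omega>) ` {1..n})"
    by (auto simp: atLeastAtMostSuc_conv)
  then show ?thesis using n by (simp add: Z_def max.commute)
qed

lemma distr_X: "1 \<le> i \<Longrightarrow> distr M borel (X i) = density lborel (\<lambda>x. ennreal (f i x))"
  using distributed_distr_eq_density[OF dist] by (simp cong: distr_cong)

text \<open>The sum and maximum of the first \<open>n\<close> variables are functions of a vector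
  independent of \<open>X (Suc n)\<close>. Fubini on the product of the two laws then conditions on
  the last variable. Since it presupposes no joint density, it also covers level 1 and serves the
  distribution functions.\<close>

lemma nn_integral_law_recursion:
  fixes \<phi> :: "real \<Rightarrow> real \<Rightarrow> ennreal"
  assumes n: "1 \<le> n" and \<phi>: "case_prod \<phi> \<in> borel_measurable (borel \<Otimes>\<^sub>M borel)"
  shows "(\<integral>\<^sup>+\<omega>. \<phi> (Y X (Suc n) \<omega>) (Z X (Suc n) \<omega>) \<partial>M) =
    (\<integral>\<^sup>+x. ennreal (f (Suc n) x) * (\<integral>\<^sup>+\<omega>. \<phi> (Y X n \<omega> + x) (max (Z X n \<omega>) x) \<partial>M) \<partial>lborel)"
proof -
  have [measurable]: "(\<lambda>x. \<phi> (u x) (v x)) \<in> borel_measurable N"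
    if "u \<in> borel_measurable N" "v \<in> borel_measurable N" for u v and N :: "'b measure"
    using measurable_compose[OF measurable_Pair[OF that] \<phi>] by simp
  note [measurable] = nice_density_measurable[OF nice_density] Z_measurable[OF n]
  \<comment> \<open>Independence of a whole family is available for disjoint blocks of indices as
    random functions; the single variable is therefore treated as a block with one element and read
    off by \<open>v (Suc n)\<close>.\<close>
  let ?A = "PiM {Suc n} (\<lambda>_. borel :: real measure)" and ?B = "PiM {1..n} (\<lambda>_. borel :: real measure)"
  let ?RA = "\<lambda>\<omega>. restrict (\<lambda>i. X i \<omega>) {Suc n}" and ?RB = "\<lambda>\<omega>. restrict (\<lambda>i. X i \<omega>) {1..n}"
  let ?S = "\<lambda>w :: nat \<Rightarrow> real. \<Sum>i=1..n. w i" and ?Mx = "\<lambda>w :: nat \<Rightarrow> real. Max ((\<lambda>i. w i) ` {1..n})"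
  have [measurable]: "?S \<in> borel_measurable ?B" "?Mx \<in> borel_measurable ?B"
    using n by (intro borel_measurable_Max borel_measurable_sum; auto)+
  have SM: "?S (?RB \<omega>) = Y X n \<omega>" "?Mx (?RB \<omega>) = Z X n \<omega>" for \<omega>
    by (simp_all add: Y_def Z_def cong: image_cong_simp)
  have "indep_var ?A ?RA ?B ?RB"
    by (rule indep_var_restrict[OF indep]) auto
  then have iv: "distr M ?A ?RA \<Otimes>\<^sub>M distr M ?B ?RB = distr M (?A \<Otimes>\<^sub>M ?B) (\<lambda>\<omega>. (?RA \<omega>, ?RB \<omega>))"
    and RA[measurable]: "?RA \<in> M \<rightarrow>\<^sub>M ?A" and RB[measurable]: "?RB \<in> M \<rightarrow>\<^sub>M ?B"
    unfolding indep_var_distribution_eq by auto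
  interpret V: prob_space "distr M ?B ?RB"
    by (rule prob_space_distr) measurable
  have YS: "Y X (Suc n) \<omega> = Y X n \<omega> + X (Suc n) \<omega>" for \<omega>
    by (simp add: Y_def)
  let ?\<psi> = "\<lambda>(v, w). \<phi> (?S w + v (Suc n)) (max (?Mx w) (v (Suc n)))"
  have \<psi>[measurable]: "?\<psi> \<in> borel_measurable (?A \<Otimes>\<^sub>M ?B)"
    by measurable
  have "(\<integral>\<^sup>+\<omega>. \<phi> (Y X (Suc n) \<omega>) (Z X (Suc n) \<omega>) \<partial>M) = (\<integral>\<^sup>+\<omega>. ?\<psi> (?RA \<omega>, ?RB \<omega>) \<partial>M)"
    unfolding prod.case SM YS Z_Suc[OF n] by simp
  also have "\<dots> = (\<integral>\<^sup>+q. ?\<psi> q \<partial>distr M (?A \<Otimes>\<^sub>M ?B) (\<lambda>\<omega>. (?RA \<omega>, ?RB \<omega>)))"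
    by (rule nn_integral_distr[symmetric]) measurable
  also have "\<dots> = (\<integral>\<^sup>+v. \<integral>\<^sup>+w. ?\<psi> (v, w) \<partial>distr M ?B ?RB \<partial>distr M ?A ?RA)"
    unfolding iv[symmetric] by (subst V.nn_integral_fst[symmetric]) auto
  also have "\<dots> = (\<integral>\<^sup>+v. \<integral>\<^sup>+\<omega>. ?\<psi> (v, ?RB \<omega>) \<partial>M \<partial>distr M ?A ?RA)"
    by (intro nn_integral_cong nn_integral_distr) auto
  also have "\<dots> = (\<integral>\<^sup>+v. (\<integral>\<^sup>+\<omega>. \<phi> (Y X n \<omega> + v (Suc n)) (max (Z X n \<omega>) (v (Suc n))) \<partial>M) \<partial>distr M ?A ?RA)"
    unfolding prod.case SM by simp
  also have "\<dots> = (\<integral>\<^sup>+\<omega>'. (\<integral>\<^sup>+\<omega>. \<phi> (Y X n \<omega> + X (Suc n) \<omega>') (max (Z X n \<omega>) (X (Suc n) \<omega>')) \<partial>M) \<partial>M)"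
    by (subst nn_integral_distr) auto
  also have "\<dots> = (\<integral>\<^sup>+x. \<integral>\<^sup>+\<omega>. \<phi> (Y X n \<omega> + x) (max (Z X n \<omega>) x) \<partial>M \<partial>distr M borel (X (Suc n)))"
    by (subst nn_integral_distr) auto
  also have "\<dots> = (\<integral>\<^sup>+x. ennreal (f (Suc n) x) * (\<integral>\<^sup>+\<omega>. \<phi> (Y X n \<omega> + x) (max (Z X n \<omega>) x) \<partial>M) \<partial>lborel)"
    unfolding distr_X[of "Suc n", simplified] by (subst nn_integral_density) auto
  finally show ?thesis .
qed


lemma nn_integral_joint_law:
  fixes \<phi> :: "real \<Rightarrow> real \<Rightarrow> ennreal"
  assumes \<phi>: "case_prod \<phi> \<in> borel_measurable (borel \<Otimes>\<^sub>M borel)"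
  shows "(\<integral>\<^sup>+\<omega>. \<phi> (Y X (n + 2) \<omega>) (Z X (n + 2) \<omega>) \<partial>M) =
    (\<integral>\<^sup>+p. ennreal (regular_pdf f n (fst p) (snd p)) * \<phi> (fst p) (snd p) \<partial>lborel)"
  using \<phi>
proof (induction n arbitrary: \<phi>)
  case (0 \<phi>)
  have [measurable]: "(\<lambda>x. \<phi> (u x) (v x)) \<in> borel_measurable N"
    if "u \<in> borel_measurable N" "v \<in> borel_measurable N" for u v and N :: "'b measure"
    using measurable_compose[OF measurable_Pair[OF that] 0] by simp
  note [measurable] = nice_density_measurable[OF nice_density]
  have 1: "(\<integral>\<^sup>+\<omega>. \<phi> (Y X 1 \<omega> + x) (max (Z X 1 \<omega>) x) \<partial>M) =
      (\<integral>\<^sup>+u. ennreal (f 1 u) * \<phi> (u + x) (max u x) \<partial>lborel)" for x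
    unfolding Y_1 Z_1 by (rule distributed_nn_integral[symmetric, OF dist]) auto
  have "(\<integral>\<^sup>+\<omega>. \<phi> (Y X (Suc 1) \<omega>) (Z X (Suc 1) \<omega>) \<partial>M) =
      (\<integral>\<^sup>+p. ennreal (pdf_two (f 1) (f (Suc 1)) (fst p) (snd p)) * \<phi> (fst p) (snd p) \<partial>lborel)"
    unfolding nn_integral_law_recursion[OF order_refl 0] 1
    by (rule pdf_two_law) (use nice_density 0 in auto)
  then show ?case by (simp add: numeral_2_eq_2)
next
  case (Suc n \<phi>)
  have [measurable]: "(\<lambda>x. \<phi> (u x) (v x)) \<in> borel_measurable N"
    if "u \<in> borel_measurable N" "v \<in> borel_measurable N" for u v and N :: "'b measure"
    using measurable_compose[OF measurable_Pair[OF that] Suc.prems] by simp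
  have 1: "(\<integral>\<^sup>+\<omega>. \<phi> (Y X (n + 2) \<omega> + x) (max (Z X (n + 2) \<omega>) x) \<partial>M) =
      (\<integral>\<^sup>+p. ennreal (regular_pdf f n (fst p) (snd p)) * \<phi> (fst p + x) (max (snd p) x) \<partial>lborel)" for x
    \<comment> \<open>The hypothesis is used for the test function
      \<open>\<lambda>a b. \<phi> (a + x) (max b x)\<close>, which is why \<open>\<phi>\<close> is
      kept arbitrary.\<close>
    by (rule Suc.IH) measurable
  have e: "Suc n + 2 = Suc (n + 2)" "n + 3 = Suc (n + 2)" by simp_all
  show ?case
    unfolding regular_pdf.simps unfolding e
    by (rule trans[OF nn_integral_law_recursion[OF _ Suc.prems]], simp)
      (unfold 1, rule pdf_step_law[OF nice_density nice_joint_regular_pdf[OF nice_density] Suc.prems], auto)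
qed

text \<open>Indicators of Borel sets as test functions determine the measure.
  \<open>borel_prod\<close> identifies the product sigma-algebra of the integral identity with the
  Borel sets of the plane.\<close>

lemma distributed_regular_pdf:
  "distributed M lborel (\<lambda>\<omega>. (Y X (n + 2) \<omega>, Z X (n + 2) \<omega>)) (\<lambda>(y, z). ennreal (regular_pdf f n y z))"
proof -
  note [measurable] = nice_joint_measurable2[OF nice_joint_regular_pdf[OF nice_density]]
  have rv[measurable]: "(\<lambda>\<omega>. (Y X (n + 2) \<omega>, Z X (n + 2) \<omega>)) \<in> M \<rightarrow>\<^sub>M borel \<Otimes>\<^sub>M borel"
    by measurable
  then have rv': "(\<lambda>\<omega>. (Y X (n + 2) \<omega>, Z X (n + 2) \<omega>)) \<in> M \<rightarrow>\<^sub>M (lborel :: (real \<times> real) measure)"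
    unfolding borel_prod by simp
  have "(\<lambda>p. ennreal (regular_pdf f n (fst p) (snd p))) \<in> borel_measurable (borel \<Otimes>\<^sub>M borel)"
    by measurable
  then have d: "(\<lambda>(y, z). ennreal (regular_pdf f n y z)) \<in> borel_measurable (lborel :: (real \<times> real) measure)"
    unfolding borel_prod by (simp add: case_prod_beta')
  have "distr M lborel (\<lambda>\<omega>. (Y X (n + 2) \<omega>, Z X (n + 2) \<omega>)) =
      density lborel (\<lambda>(y, z). ennreal (regular_pdf f n y z))"
  proof (rule measure_eqI)
    fix A assume "A \<in> sets (distr M lborel (\<lambda>\<omega>. (Y X (n + 2) \<omega>, Z X (n + 2) \<omega>)))"
    then have A: "A \<in> sets (lborel :: (real \<times> real) measure)" by simp
    then have A': "A \<in> sets (borel \<Otimes>\<^sub>M borel)" unfolding borel_prod by simp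
    have "emeasure (distr M lborel (\<lambda>\<omega>. (Y X (n + 2) \<omega>, Z X (n + 2) \<omega>))) A =
        (\<integral>\<^sup>+p. indicator A p \<partial>distr M lborel (\<lambda>\<omega>. (Y X (n + 2) \<omega>, Z X (n + 2) \<omega>)))"
      using A by (subst nn_integral_indicator) simp_all
    also have "\<dots> = (\<integral>\<^sup>+\<omega>. indicator A (Y X (n + 2) \<omega>, Z X (n + 2) \<omega>) \<partial>M)"
      using A by (intro nn_integral_distr rv') simp
    also have "\<dots> = (\<integral>\<^sup>+p. ennreal (regular_pdf f n (fst p) (snd p)) * indicator A (fst p, snd p) \<partial>lborel)"
      by (rule nn_integral_joint_law) (use A' in \<open>simp add: case_prod_beta'\<close>)
    also have "\<dots> = emeasure (density lborel (\<lambda>(y, z). ennreal (regular_pdf f n y z))) A"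
      using A by (subst emeasure_density[OF d]) (simp_all add: case_prod_beta')
    finally show "emeasure (distr M lborel (\<lambda>\<omega>. (Y X (n + 2) \<omega>, Z X (n + 2) \<omega>))) A =
        emeasure (density lborel (\<lambda>(y, z). ennreal (regular_pdf f n y z))) A" .
  qed simp
  then show ?thesis
    unfolding distributed_def using d rv' by simp
qed

end

section \<open>Passage from the hypotheses to the invariants, and restricted limits\<close>

lemma nice_density_of_distributed:
  assumes "prob_space M" and dist: "distributed M lborel U (\<lambda>x. ennreal (f x))"
    and nn: "\<And>x. 0 \<le> f x" and neg: "\<And>x. x < 0 \<Longrightarrow> f x = 0"
    and bdd: "bounded (f ` {0..})" and disc: "finite {x \<in> {0..}. \<not> continuous (at x within {0..}) f}"
  shows "nice_density f"
proof -
  interpret prob_space M by fact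
  have "(\<lambda>x. ennreal (f x)) \<in> borel_measurable borel"
    using distributed_borel_measurable[OF dist] by simp
  then have "(\<lambda>x. enn2real (ennreal (f x))) \<in> borel_measurable borel"
    by (rule borel_measurable_enn2real)
  then have m: "f \<in> borel_measurable borel"
    using nn by simp
  obtain B where B: "\<And>x. 0 \<le> x \<Longrightarrow> \<bar>f x\<bar> \<le> B"
    using bdd unfolding bounded_iff by auto
  have "f x \<le> B" for x
  proof (cases "0 \<le> x")
    case True then show ?thesis using B[of x] by linarith
  next
    case False then show ?thesis using B[of 0] neg[of x] by linarith
  qed
  moreover have "(\<integral>\<^sup>+x. ennreal (f x) \<partial>lborel) = 1"
    using distributed_nn_integral[OF dist, of "\<lambda>_. 1"] by (simp add: emeasure_space_1)
  moreover have "AE x in lborel. isCont f x"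
  proof -
    \<comment> \<open>The point 0 is discarded too: continuity within \<open>{0..}\<close> is
      one-sided there, and the extension by zero to the left may create a jump.\<close>
    let ?N = "insert 0 {x \<in> {0..}. \<not> continuous (at x within {0..}) f}"
    have "AE x in lborel. x \<notin> ?N"
      using disc by (intro AE_not_in countable_imp_null_set_lborel countable_finite) auto
    then show ?thesis
    proof eventually_elim
      case (elim x)
      show ?case
      proof (cases "0 < x")
        case True
        then have "at x within {0..} = at x"
          by (intro at_within_interior) simp
        then show ?thesis using elim True by auto
      next
        case False
        then have "x < 0" using elim by auto
        then have "eventually (\<lambda>u. u < 0) (nhds x)"
          by (intro order_tendstoD(2)[OF filterlim_ident])
        then show ?thesis
          by (intro isCont_eventually_const, eventually_elim) (simp add: neg \<open>x < 0\<close>)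
      qed
    qed
  qed
  ultimately show ?thesis
    unfolding nice_density_def using m nn neg by blast
qed

lemma marginal_integral_bounds:
  assumes h: "nice_joint n h"
  shows "\<exists>Q. \<forall>w a b. \<bar>LINT x:{a..b}|lborel. h w x\<bar> \<le> Q"
proof -
  note [measurable] = nice_joint_measurable2[OF h]
  obtain Q where Q: "\<And>w. (\<integral>\<^sup>+x. ennreal (h w x) \<partial>lborel) \<le> ennreal Q" "0 \<le> Q"
    using nice_joint_marginal_bound[OF h] by blast
  obtain C where C: "\<And>y z. h y z \<le> C" "0 \<le> C" using nice_joint_bound[OF h] by blast
  have "\<bar>LINT x:{a..b}|lborel. h w x\<bar> \<le> Q" for w a b
  proof -
    have "ennreal (LINT x:{a..b}|lborel. h w x) = (\<integral>\<^sup>+x. ennreal (h w x) * indicator {a..b} x \<partial>lborel)"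
      by (rule set_integral_bounded_nn_integral(2)) (use C nice_jointD(2)[OF h] in auto)
    also have "\<dots> \<le> ennreal Q"
      by (rule order_trans[OF nn_integral_mono Q(1)[of w]]) (auto simp: indicator_def)
    finally have "(LINT x:{a..b}|lborel. h w x) \<le> Q" using Q(2) by simp
    moreover have "0 \<le> (LINT x:{a..b}|lborel. h w x)"
      unfolding set_lebesgue_integral_def by (intro Bochner_Integration.integral_nonneg) (simp add: nice_jointD(2)[OF h])
    ultimately show ?thesis by simp
  qed
  then show ?thesis by blast
qed

text \<open>The new limits are the support conditions solved for \<open>x\<close>:
  \<open>(y - z, x) \<in> D n\<close> gives \<open>(y - z) / n \<le> x \<le> y - z\<close>, and
  \<open>(y - x, z) \<in> D n\<close> gives \<open>y - n * z \<le> x \<le> y - z\<close>, each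
  intersected with \<open>{0..z}\<close>.\<close>

lemma pdf_step_restricted:
  assumes h: "nice_joint n h" and n: "1 \<le> n"
  shows "pdf_step u h y z = u z * (LINT x:{(y - z) / real n..min (y - z) z}|lborel. h (y - z) x)
    + (LINT x:{max (y - real n * z) 0..min (y - z) z}|lborel. u x * h (y - x) z)"
proof -
  have 1: "indicator {0..z} x *\<^sub>R h (y - z) x =
      indicator {(y - z) / real n..min (y - z) z} x *\<^sub>R h (y - z) x" for x
  proof (cases "(y - z, x) \<in> D n")
    case True
    then show ?thesis using n by (auto simp: D_def indicator_def field_simps)
  qed (simp add: nice_jointD(3)[OF h])
  have 2: "indicator {0..z} x *\<^sub>R (u x * h (y - x) z) =
      indicator {max (y - real n * z) 0..min (y - z) z} x *\<^sub>R (u x * h (y - x) z)" for x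
  proof (cases "(y - x, z) \<in> D n")
    case True
    then show ?thesis by (auto simp: D_def indicator_def)
  qed (simp add: nice_jointD(3)[OF h])
  show ?thesis unfolding pdf_step_def set_lebesgue_integral_def 1 2 ..
qed

section \<open>Joint distribution functions\<close>

context independent_densities
begin

lemma joint_cdf_1: "joint_cdf M X 1 y z = measure M {\<omega> \<in> space M. X 1 \<omega> \<le> min y z}"
  unfolding joint_cdf_def Y_1 Z_1 by simp

lemma joint_cdf_1_integral: "joint_cdf M X 1 y z = (LINT x:{0..min y z}|lborel. f 1 x)"
proof -
  note [measurable] = nice_density_measurable[OF nice_density]
  obtain B where B: "\<And>x. f 1 x \<le> B" "0 \<le> B" using nice_density_bound[OF nice_density[OF order_refl]] by blast
  note f = nice_densityD(2,3)[OF nice_density[OF order_refl]]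
  have "ennreal (joint_cdf M X 1 y z) = emeasure M (X 1 -` {..min y z} \<inter> space M)"
    unfolding joint_cdf_1 emeasure_eq_measure by (auto intro!: arg_cong[where f="measure M"])
  also have "\<dots> = (\<integral>\<^sup>+x. ennreal (f 1 x) * indicator {..min y z} x \<partial>lborel)"
    by (rule distributed_emeasure[OF dist]) auto
  also have "\<dots> = (\<integral>\<^sup>+x. ennreal (f 1 x) * indicator {0..min y z} x \<partial>lborel)"
    using f(2) by (intro nn_integral_cong) (auto simp: indicator_def not_le)
  also have "\<dots> = ennreal (LINT x:{0..min y z}|lborel. f 1 x)"
    by (rule set_integral_bounded_nn_integral(2)[symmetric]) (use B f in auto)
  finally show ?thesis
    by (subst (asm) ennreal_inj)
      (auto simp: joint_cdf_def set_lebesgue_integral_def f simp del: One_nat_def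
        intro!: Bochner_Integration.integral_nonneg)
qed

lemma joint_cdf_bounds: "0 \<le> joint_cdf M X n y z" "joint_cdf M X n y z \<le> 1"
  by (auto simp: joint_cdf_def)

lemma joint_cdf_measurable [measurable]:
  assumes n: "1 \<le> n"
  shows "(\<lambda>y. joint_cdf M X n y z) \<in> borel_measurable borel"
proof (rule borel_measurable_mono, rule monoI)
  note [measurable] = Z_measurable[OF n]
  show "joint_cdf M X n y z \<le> joint_cdf M X n y' z" if "y \<le> y'" for y y'
    unfolding joint_cdf_def by (rule finite_measure_mono) (use that in auto)
qed

text \<open>The law recursion for the indicator of a quadrant:
  \<open>max (Z X n \<omega>) x \<le> z\<close> forces \<open>x \<le> z\<close>, which gives the
  upper limit, and vanishing of the density on negative arguments gives the lower one.\<close>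

lemma joint_cdf_Suc:
  assumes n: "1 \<le> n"
  shows "joint_cdf M X (Suc n) y z = (LINT x:{0..z}|lborel. joint_cdf M X n (y - x) z * f (Suc n) x)"
proof -
  note [measurable] = Z_measurable[OF n] nice_density_measurable[OF nice_density] joint_cdf_measurable[OF n]
  have [measurable]: "Z X (Suc n) \<in> borel_measurable M" by (rule Z_measurable) simp
  have nS: "nice_density (f (Suc n))" by (rule nice_density) simp
  obtain B where B: "\<And>x. f (Suc n) x \<le> B" "0 \<le> B" using nice_density_bound[OF nS] by blast
  note f = nice_densityD(2,3)[OF nS]
  let ?\<phi> = "\<lambda>a b. if a \<le> y \<and> b \<le> z then 1 else 0 :: ennreal"
  have cdf: "ennreal (joint_cdf M X k y' z) = (\<integral>\<^sup>+\<omega>. (if Y X k \<omega> \<le> y' \<and> Z X k \<omega> \<le> z then 1 else 0) \<partial>M)"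
    if [measurable]: "Z X k \<in> borel_measurable M" for k y'
  proof -
    have "ennreal (joint_cdf M X k y' z) = emeasure M {\<omega> \<in> space M. Y X k \<omega> \<le> y' \<and> Z X k \<omega> \<le> z}"
      by (simp add: joint_cdf_def emeasure_eq_measure)
    also have "\<dots> = (\<integral>\<^sup>+\<omega>. indicator {\<omega> \<in> space M. Y X k \<omega> \<le> y' \<and> Z X k \<omega> \<le> z} \<omega> \<partial>M)"
      by (rule nn_integral_indicator[symmetric]) measurable
    also have "\<dots> = (\<integral>\<^sup>+\<omega>. (if Y X k \<omega> \<le> y' \<and> Z X k \<omega> \<le> z then 1 else 0) \<partial>M)"
      by (intro nn_integral_cong) (auto simp: indicator_def)
    finally show ?thesis .
  qed
  have "ennreal (joint_cdf M X (Suc n) y z) = (\<integral>\<^sup>+\<omega>. ?\<phi> (Y X (Suc n) \<omega>) (Z X (Suc n) \<omega>) \<partial>M)"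
    by (rule cdf) measurable
  also have "\<dots> = (\<integral>\<^sup>+x. ennreal (f (Suc n) x) * (\<integral>\<^sup>+\<omega>. ?\<phi> (Y X n \<omega> + x) (max (Z X n \<omega>) x) \<partial>M) \<partial>lborel)"
    by (rule nn_integral_law_recursion[OF n]) measurable
  also have "\<dots> = (\<integral>\<^sup>+x. ennreal (joint_cdf M X n (y - x) z * f (Suc n) x) * indicator {0..z} x \<partial>lborel)"
  proof (rule nn_integral_cong)
    fix x :: real
    have "(\<integral>\<^sup>+\<omega>. ?\<phi> (Y X n \<omega> + x) (max (Z X n \<omega>) x) \<partial>M) = ennreal (joint_cdf M X n (y - x) z)" if "x \<le> z"
      unfolding cdf[OF Z_measurable[OF n]] by (intro nn_integral_cong) (use that in \<open>auto simp: le_diff_eq\<close>)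
    moreover have "(\<integral>\<^sup>+\<omega>. ?\<phi> (Y X n \<omega> + x) (max (Z X n \<omega>) x) \<partial>M) = 0" if "\<not> x \<le> z"
      using that by simp
    ultimately show "ennreal (f (Suc n) x) * (\<integral>\<^sup>+\<omega>. ?\<phi> (Y X n \<omega> + x) (max (Z X n \<omega>) x) \<partial>M) =
        ennreal (joint_cdf M X n (y - x) z * f (Suc n) x) * indicator {0..z} x"
      using f joint_cdf_bounds(1)[of n "y - x" z]
      by (cases "x < 0"; cases "x \<le> z") (simp_all add: indicator_def ennreal_mult mult.commute)
  qed
  also have "\<dots> = ennreal (LINT x:{0..z}|lborel. joint_cdf M X n (y - x) z * f (Suc n) x)"
  proof (rule set_integral_bounded_nn_integral(2)[symmetric])
    show "joint_cdf M X n (y - x) z * f (Suc n) x \<le> 1 * B" for x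
      by (intro mult_mono joint_cdf_bounds B f) simp
  qed (auto simp: joint_cdf_bounds f)
  finally show ?thesis
    by (subst (asm) ennreal_inj)
      (auto simp: joint_cdf_bounds set_lebesgue_integral_def f intro!: Bochner_Integration.integral_nonneg)
qed

lemma joint_cdf_neg:
  assumes n: "1 \<le> n" and y: "y < 0"
  shows "joint_cdf M X n y z = 0"
proof -
  note [measurable] = Z_measurable[OF n]
  have "AE \<omega> in M. \<forall>i\<in>{1..n}. 0 \<le> X i \<omega>"
    by (intro AE_finite_allI) (auto intro: X_nonneg)
  then have "AE \<omega> in M. \<not> (Y X n \<omega> \<le> y \<and> Z X n \<omega> \<le> z)"
  proof eventually_elim
    case (elim \<omega>)
    then have "0 \<le> Y X n \<omega>" by (auto simp: Y_def intro!: sum_nonneg)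
    then show ?case using y by auto
  qed
  then have "measure M {\<omega> \<in> space M. Y X n \<omega> \<le> y \<and> Z X n \<omega> \<le> z} = measure M {}"
    by (intro measure_eq_AE) auto
  then show ?thesis by (simp add: joint_cdf_def)
qed

text \<open>At level 1 only the endpoint of the interval moves; at higher levels the integrand is
  continuous for every \<open>x\<close> by induction, and the moving endpoint costs one value of
  \<open>x\<close>. Distribution functions are at most 1, so the density of the last variable
  dominates.\<close>

lemma joint_cdf_isCont: "isCont (\<lambda>p. joint_cdf M X (Suc n) (fst p) (snd p)) q"
proof (induction n arbitrary: q)
  case 0
  note [measurable] = nice_density_measurable[OF nice_density]
  have f: "nice_density (f 1)" by (rule nice_density) simp
  have ne: "AE x in lborel. x \<noteq> min (fst q) (snd q)" by (rule AE_lborel_singleton)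
  have "isCont (\<lambda>p. LINT x:{0..min (fst p) (snd p)}|lborel. f 1 x) q"
    unfolding set_lebesgue_integral_def
  proof (rule isCont_lebesgue_integral)
    show "integrable lborel (f 1)" by (rule nice_density_integrable[OF f])
    show "AE x in lborel. isCont (\<lambda>p. indicator {0..min (fst p) (snd p)} x *\<^sub>R f 1 x) q"
      using ne by eventually_elim (intro continuous_intros isCont_indicator_Icc, auto)
    show "\<forall>\<^sub>F p in nhds q. AE x in lborel. norm (indicator {0..min (fst p) (snd p)} x *\<^sub>R f 1 x) \<le> f 1 x"
      by (intro always_eventually allI AE_I2) (auto simp: indicator_def nice_densityD[OF f] simp del: One_nat_def)
  qed simp
  then show ?case
    by (simp only: joint_cdf_1_integral One_nat_def[symmetric])
next
  case (Suc n)
  have f: "nice_density (f (Suc (Suc n)))" by (rule nice_density) simp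
  note [measurable] = nice_density_measurable[OF f]
  have [measurable]: "(\<lambda>y. joint_cdf M X (Suc n) y z) \<in> borel_measurable borel" for z
    by (rule joint_cdf_measurable) simp
  have ne: "AE x in lborel. x \<noteq> snd q" by (rule AE_lborel_singleton)
  have c: "isCont (\<lambda>p. joint_cdf M X (Suc n) (fst p - x) (snd p)) q" for x
  proof -
    have "isCont (\<lambda>p. (fst p - x, snd p)) q" by (intro continuous_intros)
    from isCont_o2[OF this Suc.IH] show ?thesis by simp
  qed
  have "isCont (\<lambda>p. LINT x:{0..snd p}|lborel. joint_cdf M X (Suc n) (fst p - x) (snd p) * f (Suc (Suc n)) x) q"
    unfolding set_lebesgue_integral_def
  proof (rule isCont_lebesgue_integral)
    show "integrable lborel (f (Suc (Suc n)))" by (rule nice_density_integrable[OF f])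
    show "AE x in lborel. isCont (\<lambda>p. indicator {0..snd p} x *\<^sub>R
        (joint_cdf M X (Suc n) (fst p - x) (snd p) * f (Suc (Suc n)) x)) q"
      using ne by eventually_elim (intro continuous_intros isCont_indicator_Icc c, auto)
    have "\<bar>joint_cdf M X (Suc n) a b * f (Suc (Suc n)) x\<bar> \<le> f (Suc (Suc n)) x" for a b x
      using mult_right_mono[OF joint_cdf_bounds(2) nice_densityD(2)[OF f], of "Suc n" a b x]
      by (simp add: abs_mult joint_cdf_bounds(1) nice_densityD(2)[OF f])
    then show "\<forall>\<^sub>F p in nhds q. AE x in lborel. norm (indicator {0..snd p} x *\<^sub>R
        (joint_cdf M X (Suc n) (fst p - x) (snd p) * f (Suc (Suc n)) x)) \<le> f (Suc (Suc n)) x"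
      by (intro always_eventually allI AE_I2) (auto simp: indicator_def nice_densityD(2)[OF f])
  qed simp
  then show ?case
    by (simp only: joint_cdf_Suc[of "Suc n", simplified])
qed

text \<open>The density is integrated over a quadrant; its vanishing at negative coordinates turns
  the quadrant into \<open>{0..y} \<times> {0..z}\<close>.\<close>

lemma joint_cdf_integral_regular_pdf:
  "joint_cdf M X (n + 2) y z =
    (LINT z':{0..z}|lborel. (LINT y':{0..y}|lborel. regular_pdf f n y' z'))"
proof -
  let ?h = "regular_pdf f n"
  have h: "nice_joint (n + 2) ?h" by (rule nice_joint_regular_pdf[OF nice_density])
  note [measurable] = nice_joint_measurable2[OF h] indicator_Icc_measurable_ennreal
  obtain C where C: "\<And>y z. ?h y z \<le> C" "0 \<le> C" using nice_joint_bound[OF h] by blast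
  have inner: "ennreal (LINT y':{0..y}|lborel. ?h y' z') = (\<integral>\<^sup>+y'. ennreal (?h y' z') * indicator {0..y} y' \<partial>lborel)"
    for z' by (rule set_integral_bounded_nn_integral(2)) (use C nice_jointD(2)[OF h] in auto)
  have nonneg: "0 \<le> (LINT y':{0..y}|lborel. ?h y' z')" for z'
    unfolding set_lebesgue_integral_def
    by (intro Bochner_Integration.integral_nonneg) (simp add: nice_jointD(2)[OF h])
  \<comment> \<open>A bound uniform in \<open>z'\<close> is what converts the outer integral;
    \<open>max 0 y\<close> is the length of \<open>{0..y}\<close>, also when this is empty.\<close>
  have bound: "(LINT y':{0..y}|lborel. ?h y' z') \<le> C * max 0 y" for z'
  proof -
    have "ennreal (LINT y':{0..y}|lborel. ?h y' z') \<le> (\<integral>\<^sup>+y'. ennreal C * indicator {0..y} y' \<partial>lborel)"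
      unfolding inner using C by (intro nn_integral_mono mult_right_mono ennreal_leI) auto
    also have "\<dots> = ennreal (C * max 0 y)"
      using C by (cases "0 \<le> y") (auto simp: nn_integral_cmult_indicator ennreal_mult)
    finally show ?thesis using C by (subst (asm) ennreal_le_iff) auto
  qed
  have meas: "(\<lambda>z'. LINT y':{0..y}|lborel. ?h y' z') \<in> borel_measurable borel"
    unfolding set_lebesgue_integral_def by measurable
  have neg: "?h y' z' = 0" if "y' < 0 \<or> z' < 0" for y' z'
    by (rule nice_jointD(3)[OF h]) (use that in \<open>auto simp: D_def\<close>)
  have ZM[measurable]: "Z X (n + 2) \<in> borel_measurable M" by (rule Z_measurable) simp
  let ?\<phi> = "\<lambda>a b. if a \<le> y \<and> b \<le> z then 1 else 0 :: ennreal"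
  have "ennreal (joint_cdf M X (n + 2) y z) =
      emeasure M {\<omega> \<in> space M. Y X (n + 2) \<omega> \<le> y \<and> Z X (n + 2) \<omega> \<le> z}"
    by (simp add: joint_cdf_def emeasure_eq_measure)
  also have "\<dots> = (\<integral>\<^sup>+\<omega>. indicator {\<omega> \<in> space M. Y X (n + 2) \<omega> \<le> y \<and> Z X (n + 2) \<omega> \<le> z} \<omega> \<partial>M)"
    by (rule nn_integral_indicator[symmetric]) measurable
  also have "\<dots> = (\<integral>\<^sup>+\<omega>. ?\<phi> (Y X (n + 2) \<omega>) (Z X (n + 2) \<omega>) \<partial>M)"
    by (intro nn_integral_cong) (auto simp: indicator_def)
  also have "\<dots> = (\<integral>\<^sup>+p. ennreal (?h (fst p) (snd p)) * ?\<phi> (fst p) (snd p) \<partial>lborel)"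
    by (rule nn_integral_joint_law) measurable
  also have "\<dots> = (\<integral>\<^sup>+z'. \<integral>\<^sup>+y'. ennreal (?h y' z') * ?\<phi> y' z' \<partial>lborel \<partial>lborel)"
    unfolding lborel_prod[symmetric] by (subst lborel_pair.nn_integral_snd[symmetric]) auto
  also have "\<dots> = (\<integral>\<^sup>+z'. (\<integral>\<^sup>+y'. ennreal (?h y' z') * indicator {0..y} y' \<partial>lborel) * indicator {0..z} z' \<partial>lborel)"
  proof (rule nn_integral_cong)
    fix z' :: real
    show "(\<integral>\<^sup>+y'. ennreal (?h y' z') * ?\<phi> y' z' \<partial>lborel) =
        (\<integral>\<^sup>+y'. ennreal (?h y' z') * indicator {0..y} y' \<partial>lborel) * indicator {0..z} z'"
      by (subst nn_integral_multc[symmetric], simp)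
        (intro nn_integral_cong, auto simp: indicator_def neg not_le)
  qed
  also have "\<dots> = ennreal (LINT z':{0..z}|lborel. (LINT y':{0..y}|lborel. ?h y' z'))"
    unfolding inner[symmetric]
    by (rule set_integral_bounded_nn_integral(2)[symmetric, OF meas nonneg bound])
  finally show ?thesis
    by (subst (asm) ennreal_inj)
      (auto simp: joint_cdf_bounds set_lebesgue_integral_def[of _ "{0..z}"] nonneg
        intro!: Bochner_Integration.integral_nonneg)
qed

end

section \<open>Assembly of the recursion, continuity, density and boundedness claims\<close>

theorem mainTheorem5:
  fixes M :: "'a measure"
    and X :: "nat \<Rightarrow> 'a \<Rightarrow> real"
    and f :: "nat \<Rightarrow> real \<Rightarrow> real"
  assumes "prob_space M"
    and "prob_space.indep_vars M (\<lambda>_. borel) X {1..}"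
    and "\<And>i. i \<ge> 1 \<Longrightarrow> AE \<omega> in M. 0 \<le> X i \<omega>"
    and "\<And>i. i \<ge> 1 \<Longrightarrow> distributed M lborel (X i) (\<lambda>x. ennreal (f i x))"
    and "\<And>i x. i \<ge> 1 \<Longrightarrow> 0 \<le> f i x"
    and "\<And>i x. i \<ge> 1 \<Longrightarrow> x < 0 \<Longrightarrow> f i x = 0"
    and "\<And>i. i \<ge> 1 \<Longrightarrow> bounded (f i ` {0..})"
    and "\<And>i. i \<ge> 1 \<Longrightarrow> finite {x \<in> {0..}. \<not> continuous (at x within {0..}) (f i)}"
  defines "G \<equiv> joint_cdf M X"
    and "g \<equiv> joint_pdf f"
  shows
    "(\<forall>n\<ge>2. \<forall>y\<ge>0. \<forall>z\<ge>0.
        G n y z = (LINT x:{0..z}|lborel. G (n - 1) (y - x) z * f n x) \<and>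
        G n y z = (LINT x:{0..min y z}|lborel. G (n - 1) (y - x) z * f n x))
     \<and> (\<forall>y\<ge>0. \<forall>z\<ge>0. G 1 y z = cdf (distr M borel (X 1)) (min y z))
     \<and> (\<forall>n\<ge>1. continuous_on ({0..} \<times> {0..}) (\<lambda>(y, z). G n y z))
     \<and> (\<forall>n\<ge>1. \<forall>y\<ge>0. \<forall>z\<ge>0.
          G n y z = (LINT z':{0..z}|lborel. line_integral (g n) (\<lambda>_. 1) (\<lambda>y'. (y', z')) 0 y))
     \<and> g 1 = Diagonal (\<lambda>y z. f 1 y)
     \<and> (\<forall>\<phi> y z a b.
          line_integral (g 1) \<phi> (\<lambda>x. (y, x)) a b
            = line_integral (Diagonal (\<lambda>y z. f 1 z)) \<phi> (\<lambda>x. (y, x)) a b \<and>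
          line_integral (g 1) \<phi> (\<lambda>x. (x, z)) a b
            = line_integral (Diagonal (\<lambda>y z. f 1 z)) \<phi> (\<lambda>x. (x, z)) a b \<and>
          line_integral (g 1) \<phi> (\<lambda>x. (y - x, z)) a b
            = line_integral (Diagonal (\<lambda>y z. f 1 z)) \<phi> (\<lambda>x. (y - x, z)) a b)
     \<and> (\<forall>n\<ge>2. \<exists>h. g n = Regular h
          \<and> (\<forall>y z. 0 \<le> h y z)
          \<and> distributed M lborel (\<lambda>\<omega>. (Y X n \<omega>, Z X n \<omega>)) (\<lambda>(y, z). ennreal (h y z))
          \<and> (\<forall>y z. (y, z) \<notin> D n \<longrightarrow> h y z = 0)
          \<and> (\<forall>y z. (y, z) \<in> D n \<longrightarrow>
               h y z = f n z * line_integral (g (n - 1)) (\<lambda>_. 1) (\<lambda>x. (y - z, x)) 0 z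
                     + line_integral (g (n - 1)) (f n) (\<lambda>x. (y - x, z)) 0 z \<and>
               h y z = f n z * line_integral (g (n - 1)) (\<lambda>_. 1) (\<lambda>x. (y - z, x))
                                 ((y - z) / real (n - 1)) (min (y - z) z)
                     + line_integral (g (n - 1)) (f n) (\<lambda>x. (y - x, z))
                                 (max (y - real (n - 1) * z) 0) (min (y - z) z))
          \<and> (AE p in (lborel :: (real \<times> real) measure).
               p \<in> D n \<longrightarrow> isCont (\<lambda>(y, z). h y z) p)
          \<and> bounded ((\<lambda>(y, z). h y z) ` D n)
          \<and> bounded ((\<lambda>(y, z). line_integral (g n) (\<lambda>_. 1) (\<lambda>x. (y - z, x)) 0 z) ` D (n + 1)))"
proof -
  have nice_density: "nice_density (f i)" if "1 \<le> i" for i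
    using nice_density_of_distributed[OF assms(1) assms(4) assms(5) assms(6) assms(7) assms(8)] that by blast
  interpret prob_space M by fact
  interpret independent_densities M X f
    by unfold_locales (use assms nice_density in auto)
  have regular: "g (k + 2) = Regular (regular_pdf f k)" for k
    unfolding g_def by (rule joint_pdf_regular[OF nice_density])
  have g1: "g 1 = Diagonal (\<lambda>y z. f 1 y)"
    unfolding g_def by simp

  have recursion: "\<forall>n\<ge>2. \<forall>y\<ge>0. \<forall>z\<ge>0.
        G n y z = (LINT x:{0..z}|lborel. G (n - 1) (y - x) z * f n x) \<and>
        G n y z = (LINT x:{0..min y z}|lborel. G (n - 1) (y - x) z * f n x)"
  proof (intro allI impI)
    fix n :: nat and y z :: real
    assume n: "2 \<le> n" and "0 \<le> y" "0 \<le> z"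
    then have n1: "1 \<le> n - 1" "Suc (n - 1) = n" by auto
    have 1: "G n y z = (LINT x:{0..z}|lborel. G (n - 1) (y - x) z * f n x)"
      unfolding G_def using joint_cdf_Suc[OF n1(1)] unfolding n1(2) .
    \<comment> \<open>For \<open>x > y\<close> the first argument \<open>y - x\<close> is negative,
      and the sum of almost surely nonnegative variables stays below it with probability 0.\<close>
    have "indicator {0..z} x *\<^sub>R (G (n - 1) (y - x) z * f n x) =
        indicator {0..min y z} x *\<^sub>R (G (n - 1) (y - x) z * f n x)" for x
      using joint_cdf_neg[OF n1(1), of "y - x" z] by (auto simp: G_def indicator_def not_le)
    then have "(LINT x:{0..z}|lborel. G (n - 1) (y - x) z * f n x) =
        (LINT x:{0..min y z}|lborel. G (n - 1) (y - x) z * f n x)"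
      unfolding set_lebesgue_integral_def by (rule Bochner_Integration.integral_cong[OF refl])
    with 1 show "G n y z = (LINT x:{0..z}|lborel. G (n - 1) (y - x) z * f n x) \<and>
        G n y z = (LINT x:{0..min y z}|lborel. G (n - 1) (y - x) z * f n x)"
      by simp
  qed

  have initial: "\<forall>y\<ge>0. \<forall>z\<ge>0. G 1 y z = cdf (distr M borel (X 1)) (min y z)"
  proof (intro allI impI)
    fix y z :: real
    have "X 1 -` {..min y z} \<inter> space M = {\<omega> \<in> space M. X 1 \<omega> \<le> min y z}" by auto
    then show "G 1 y z = cdf (distr M borel (X 1)) (min y z)"
      unfolding G_def joint_cdf_1 cdf_def by (subst measure_distr) auto
  qed

  have continuous: "\<forall>n\<ge>1. continuous_on ({0..} \<times> {0..}) (\<lambda>(y, z). G n y z)"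
  proof (intro allI impI)
    fix n :: nat assume "1 \<le> n"
    then obtain k where k: "n = Suc k" by (cases n) auto
    show "continuous_on ({0..} \<times> {0..}) (\<lambda>(y, z). G n y z)"
      unfolding G_def k case_prod_beta' by (intro continuous_at_imp_continuous_on ballI joint_cdf_isCont)
  qed

  \<comment> \<open>The delta is evaluated where both coordinates agree, so \<open>f 1 y\<close> and
    \<open>f 1 z\<close> take the same value there.\<close>
  have diagonal: "line_integral (g 1) \<phi> (\<lambda>x. (y, x)) a b
            = line_integral (Diagonal (\<lambda>y z. f 1 z)) \<phi> (\<lambda>x. (y, x)) a b"
      "line_integral (g 1) \<phi> (\<lambda>x. (x, z)) a b
            = line_integral (Diagonal (\<lambda>y z. f 1 z)) \<phi> (\<lambda>x. (x, z)) a b"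
      "line_integral (g 1) \<phi> (\<lambda>x. (y - x, z)) a b
            = line_integral (Diagonal (\<lambda>y z. f 1 z)) \<phi> (\<lambda>x. (y - x, z)) a b" for \<phi> y z a b
    unfolding g1 by (simp_all add: the_diff the_eq_var Let_def)

  have density: "\<forall>n\<ge>1. \<forall>y\<ge>0. \<forall>z\<ge>0.
      G n y z = (LINT z':{0..z}|lborel. line_integral (g n) (\<lambda>_. 1) (\<lambda>y'. (y', z')) 0 y)"
  proof (intro allI impI)
    fix n :: nat and y z :: real
    assume n: "1 \<le> n"
    show "G n y z = (LINT z':{0..z}|lborel. line_integral (g n) (\<lambda>_. 1) (\<lambda>y'. (y', z')) 0 y)"
    proof (cases "n = 1")
      case True
      \<comment> \<open>The inner delta integral is \<open>f 1 z'\<close> exactly when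
        \<open>0 \<le> z' \<le> y\<close>; with the outer range \<open>{0..z}\<close> this leaves
        \<open>{0..min y z}\<close>.\<close>
      have "indicator {0..z} z' *\<^sub>R line_integral (g 1) (\<lambda>_. 1) (\<lambda>y'. (y', z')) 0 y =
          indicator {0..min y z} z' *\<^sub>R f 1 z'" for z'
        unfolding g1 by (auto simp: the_eq_var indicator_def)
      then show ?thesis
        unfolding True G_def joint_cdf_1_integral set_lebesgue_integral_def by simp
    next
      case False
      then obtain k where k: "n = k + 2"
        using n by (metis add.commute le_Suc_ex one_add_one Suc_eq_plus1 Suc_leI le_neq_implies_less)
      show ?thesis
        unfolding k regular G_def joint_cdf_integral_regular_pdf by simp
    qed
  qed

  have regular_properties: "\<exists>h. g n = Regular h
          \<and> (\<forall>y z. 0 \<le> h y z)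
          \<and> distributed M lborel (\<lambda>\<omega>. (Y X n \<omega>, Z X n \<omega>)) (\<lambda>(y, z). ennreal (h y z))
          \<and> (\<forall>y z. (y, z) \<notin> D n \<longrightarrow> h y z = 0)
          \<and> (\<forall>y z. (y, z) \<in> D n \<longrightarrow>
               h y z = f n z * line_integral (g (n - 1)) (\<lambda>_. 1) (\<lambda>x. (y - z, x)) 0 z
                     + line_integral (g (n - 1)) (f n) (\<lambda>x. (y - x, z)) 0 z \<and>
               h y z = f n z * line_integral (g (n - 1)) (\<lambda>_. 1) (\<lambda>x. (y - z, x))
                                 ((y - z) / real (n - 1)) (min (y - z) z)
                     + line_integral (g (n - 1)) (f n) (\<lambda>x. (y - x, z))
                                 (max (y - real (n - 1) * z) 0) (min (y - z) z))
          \<and> (AE p in (lborel :: (real \<times> real) measure).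
               p \<in> D n \<longrightarrow> isCont (\<lambda>(y, z). h y z) p)
          \<and> bounded ((\<lambda>(y, z). h y z) ` D n)
          \<and> bounded ((\<lambda>(y, z). line_integral (g n) (\<lambda>_. 1) (\<lambda>x. (y - z, x)) 0 z) ` D (n + 1))"
    if n: "2 \<le> n" for n
  proof -
    obtain k where k: "n = k + 2"
      using n by (metis add.commute le_Suc_ex)
    let ?h = "regular_pdf f k"
    have h: "nice_joint n ?h" unfolding k by (rule nice_joint_regular_pdf[OF nice_density])
    have formula: "?h y z = f n z * line_integral (g (n - 1)) (\<lambda>_. 1) (\<lambda>x. (y - z, x)) 0 z
                     + line_integral (g (n - 1)) (f n) (\<lambda>x. (y - x, z)) 0 z"
      "?h y z = f n z * line_integral (g (n - 1)) (\<lambda>_. 1) (\<lambda>x. (y - z, x))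
                                 ((y - z) / real (n - 1)) (min (y - z) z)
                     + line_integral (g (n - 1)) (f n) (\<lambda>x. (y - x, z))
                                 (max (y - real (n - 1) * z) 0) (min (y - z) z)"
      if D: "(y, z) \<in> D n" for y z
    proof -
      have "?h y z = f n z * line_integral (g (n - 1)) (\<lambda>_. 1) (\<lambda>x. (y - z, x)) 0 z
                     + line_integral (g (n - 1)) (f n) (\<lambda>x. (y - x, z)) 0 z \<and>
        ?h y z = f n z * line_integral (g (n - 1)) (\<lambda>_. 1) (\<lambda>x. (y - z, x))
                                 ((y - z) / real (n - 1)) (min (y - z) z)
                     + line_integral (g (n - 1)) (f n) (\<lambda>x. (y - x, z))
                                 (max (y - real (n - 1) * z) 0) (min (y - z) z)"
      proof (cases k)
        case 0
        then have n2: "n = 2" "n - 1 = 1" using k by auto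
        \<comment> \<open>For level 2 both restricted intervals collapse to the single point
          \<open>y - z\<close>, where each line meets the diagonal. The delta convention gives full
          mass in this degenerate case, so the two formulas agree.\<close>
        have "0 \<le> y - z \<and> y - z \<le> z" using D n2 by (auto simp: D_def)
        then show ?thesis
          using D unfolding n2(2) g1 unfolding 0 n2(1) by (simp add: pdf_two_def the_diff the_eq_var Let_def)
      next
        case (Suc j)
        then have e: "n - 1 = j + 2" "n = j + 3" "real (n - 1) = real (j + 2)" using k by auto
        have j: "nice_joint (j + 2) (regular_pdf f j)" by (rule nice_joint_regular_pdf[OF nice_density])
        have "?h = pdf_step (f n) (regular_pdf f j)" using Suc e by simp
        then show ?thesis
          using pdf_step_restricted[OF j, of "f n" y z]
          unfolding e(1) regular by (simp add: pdf_step_def)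
      qed
      then show "?h y z = f n z * line_integral (g (n - 1)) (\<lambda>_. 1) (\<lambda>x. (y - z, x)) 0 z
                     + line_integral (g (n - 1)) (f n) (\<lambda>x. (y - x, z)) 0 z"
        "?h y z = f n z * line_integral (g (n - 1)) (\<lambda>_. 1) (\<lambda>x. (y - z, x))
                                 ((y - z) / real (n - 1)) (min (y - z) z)
                     + line_integral (g (n - 1)) (f n) (\<lambda>x. (y - x, z))
                                 (max (y - real (n - 1) * z) 0) (min (y - z) z)"
        by blast+
    qed
    obtain C where C: "\<And>y z. ?h y z \<le> C" using nice_joint_bound[OF h] by blast
    obtain Q where Q: "\<And>w a b. \<bar>LINT x:{a..b}|lborel. ?h w x\<bar> \<le> Q"
      using marginal_integral_bounds[OF h] by blast
    have gn: "g n = Regular ?h" unfolding k by (rule regular)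
    have "AE p in (lborel :: (real \<times> real) measure). p \<in> D n \<longrightarrow> isCont (\<lambda>(y, z). ?h y z) p"
      using nice_jointD(4)[OF h] by (auto simp: case_prod_beta' elim: eventually_mono)
    moreover have "bounded ((\<lambda>(y, z). ?h y z) ` D n)"
      by (intro boundedI[of _ C]) (auto simp: C nice_jointD(2)[OF h])
    moreover have "bounded ((\<lambda>(y, z). line_integral (g n) (\<lambda>_. 1) (\<lambda>x. (y - z, x)) 0 z) ` D (n + 1))"
      unfolding gn by (intro boundedI[of _ Q]) (auto simp: Q)
    moreover have "distributed M lborel (\<lambda>\<omega>. (Y X n \<omega>, Z X n \<omega>)) (\<lambda>(y, z). ennreal (?h y z))"
      unfolding k by (rule distributed_regular_pdf)
    moreover have "\<forall>y z. 0 \<le> ?h y z" "\<forall>y z. (y, z) \<notin> D n \<longrightarrow> ?h y z = 0"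
      using nice_jointD(2,3)[OF h] by auto
    moreover have "\<forall>y z. (y, z) \<in> D n \<longrightarrow>
               ?h y z = f n z * line_integral (g (n - 1)) (\<lambda>_. 1) (\<lambda>x. (y - z, x)) 0 z
                     + line_integral (g (n - 1)) (f n) (\<lambda>x. (y - x, z)) 0 z \<and>
               ?h y z = f n z * line_integral (g (n - 1)) (\<lambda>_. 1) (\<lambda>x. (y - z, x))
                                 ((y - z) / real (n - 1)) (min (y - z) z)
                     + line_integral (g (n - 1)) (f n) (\<lambda>x. (y - x, z))
                                 (max (y - real (n - 1) * z) 0) (min (y - z) z)"
      using formula by blast
    ultimately show ?thesis using gn by (intro exI[of _ ?h] conjI)
  qed
  show ?thesis
    by (intro conjI recursion initial continuous density g1 allI impI diagonal regular_properties)
qed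

end
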